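(* For any $\beta\in(-1,1)$ there exists $\omega_0>0$ (depending on $\beta$) such that for every $\omega\in(0,\omega_0)$ there exists no nontrivial (i.e. not identically zero) tuple of real-valued functions $(C_1,S_1,C_2,S_2,C_N,S_N,C_V,S_V)$ on $\mathbb{R}$ with $$C_1,S_1,C_2,S_2,C_N,S_N,C_V,S_V\in L^\infty(\mathbb{R}),\qquad C_1',S_1',C_2',S_2',C_N',S_N',C_V',S_V'\in L^2(\mathbb{R})$$ that satisfies, with $\lambda=1$, the system $$ \left\{\begin{aligned} L_-C_2&=\lambda S_1\\ L_+S_1&=\lambda C_2+QS_N\\ L_-S_2&=-\lambda C_1\\ L_+C_1&=-\lambda S_2+QC_N \end{aligned}\right. \qquad \left\{\begin{aligned} C_V'-\beta C_N'&=-\lambda\sqrt{\omega}\,(S_N+2QS_1)\\ S_V'-\beta S_N'&=\lambda\sqrt{\omega}\,(C_N+2QC_1)\\ C_N'-\beta C_V'&=-\lambda\sqrt{\omega}\,(S_V+2\beta QS_1)\\ S_N'-\beta S_V'&=\lambda\sqrt{\omega}\,(C_V+2\beta QC_1). \end{aligned}\right. $$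
   Context: $Q(y)=\frac{\sqrt2}{\cosh y}$, which satisfies $Q''+Q^3=Q$ on $\mathbb{R}$. $L_+=-\partial_y^2+1-3Q^2$ and $L_-=-\partial_y^2+1-Q^2$. Primes denote $\frac{d}{dy}$. The equations are understood in the sense of distributions on $\mathbb{R}$. *)

theory Defs
  imports "HOL-Analysis.Analysis"
begin

definition test_fun :: "(real \<Rightarrow> real) \<Rightarrow> bool" where
  "test_fun \<phi> \<longleftrightarrow>
     (\<forall>k x. (deriv ^^ k) \<phi> differentiable (at x)) \<and> compact (closure {x. \<phi> x \<noteq> 0})"

(* A distribution is represented by its action on test functions; its values at other
   functions are irrelevant, so equality of distributions is dist_eq, not HOL equality. *)
type_synonym dist = "(real \<Rightarrow> real) \<Rightarrow> real"

definition dist_eq :: "dist \<Rightarrow> dist \<Rightarrow> bool"  (infix "\<doteq>" 50) where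
  "T \<doteq> U \<longleftrightarrow> (\<forall>\<phi>. test_fun \<phi> \<longrightarrow> T \<phi> = U \<phi>)"

(* The distribution induced by a locally integrable function. *)
definition dist_of :: "(real \<Rightarrow> real) \<Rightarrow> dist" where
  "dist_of f = (\<lambda>\<phi>. \<integral>y. f y * \<phi> y \<partial>lebesgue)"

definition dist_deriv :: "dist \<Rightarrow> dist" where
  "dist_deriv T = (\<lambda>\<phi>. - T (deriv \<phi>))"

(* The product of a smooth function and a distribution. *)
definition dist_mult :: "(real \<Rightarrow> real) \<Rightarrow> dist \<Rightarrow> dist" where
  "dist_mult a T = (\<lambda>\<phi>. T (\<lambda>y. a y * \<phi> y))"

definition Linfty :: "(real \<Rightarrow> real) set" where
  "Linfty = {f. f \<in> borel_measurable lebesgue \<and> (\<exists>M. AE y in lebesgue. \<bar>f y\<bar> \<le> M)}"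

definition L2 :: "(real \<Rightarrow> real) set" where
  "L2 = {f. f \<in> borel_measurable lebesgue \<and> integrable lebesgue (\<lambda>y. (f y)\<^sup>2)}"

definition deriv_in_L2 :: "(real \<Rightarrow> real) \<Rightarrow> bool" where
  "deriv_in_L2 f \<longleftrightarrow> (\<exists>g\<in>L2. dist_deriv (dist_of f) \<doteq> dist_of g)"

definition Q :: "real \<Rightarrow> real" where
  "Q y = sqrt 2 / cosh y"

definition L_plus :: "dist \<Rightarrow> dist" where
  "L_plus T = (\<lambda>\<phi>. - dist_deriv (dist_deriv T) \<phi> + T \<phi> - 3 * dist_mult (\<lambda>y. (Q y)\<^sup>2) T \<phi>)"

definition L_minus :: "dist \<Rightarrow> dist" where
  "L_minus T = (\<lambda>\<phi>. - dist_deriv (dist_deriv T) \<phi> + T \<phi> - dist_mult (\<lambda>y. (Q y)\<^sup>2) T \<phi>)"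

(* The left-hand side f' - \<beta> g' of the first-order equations. *)
definition transport :: "real \<Rightarrow> (real \<Rightarrow> real) \<Rightarrow> (real \<Rightarrow> real) \<Rightarrow> dist" where
  "transport \<beta> f g = (\<lambda>\<phi>. dist_deriv (dist_of f) \<phi> - \<beta> * dist_deriv (dist_of g) \<phi>)"

(* \<mu> is the eigenvalue parameter, usually written \<lambda>, which is reserved in HOL. *)
definition spectral_system ::
  "real \<Rightarrow> real \<Rightarrow> real \<Rightarrow> (real \<Rightarrow> real) \<Rightarrow> (real \<Rightarrow> real) \<Rightarrow> (real \<Rightarrow> real) \<Rightarrow> (real \<Rightarrow> real) \<Rightarrow>
   (real \<Rightarrow> real) \<Rightarrow> (real \<Rightarrow> real) \<Rightarrow> (real \<Rightarrow> real) \<Rightarrow> (real \<Rightarrow> real) \<Rightarrow> bool" where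
  "spectral_system \<beta> \<omega> \<mu> C1 S1 C2 S2 CN SN CV SV \<longleftrightarrow>
     L_minus (dist_of C2) \<doteq> dist_of (\<lambda>y. \<mu> * S1 y) \<and>
     L_plus (dist_of S1) \<doteq> dist_of (\<lambda>y. \<mu> * C2 y + Q y * SN y) \<and>
     L_minus (dist_of S2) \<doteq> dist_of (\<lambda>y. - \<mu> * C1 y) \<and>
     L_plus (dist_of C1) \<doteq> dist_of (\<lambda>y. - \<mu> * S2 y + Q y * CN y) \<and>
     transport \<beta> CV CN \<doteq> dist_of (\<lambda>y. - \<mu> * sqrt \<omega> * (SN y + 2 * Q y * S1 y)) \<and>
     transport \<beta> SV SN \<doteq> dist_of (\<lambda>y. \<mu> * sqrt \<omega> * (CN y + 2 * Q y * C1 y)) \<and>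
     transport \<beta> CN CV \<doteq> dist_of (\<lambda>y. - \<mu> * sqrt \<omega> * (SV y + 2 * \<beta> * Q y * S1 y)) \<and>
     transport \<beta> SN SV \<doteq> dist_of (\<lambda>y. \<mu> * sqrt \<omega> * (CV y + 2 * \<beta> * Q y * C1 y))"

end

theory Submission
  imports Defs
begin

text \<open>As \<omega> tends to 0 the last four equations make \<open>C\<^sub>N, S\<^sub>N, C\<^sub>V, S\<^sub>V\<close> negligible, and without them the first four are
the linearized cubic Schroedinger system, whose bounded solutions at \<lambda> = 1 are spanned by the threshold
resonance \<open>(1 - Q\<^sup>2, 1)\<close>. The theorem says that this resonance does not survive when \<omega> > 0
is small. With \<open>(U, W, N)\<close> standing for \<open>(C\<^sub>1, -S\<^sub>2, C\<^sub>N)\<close> or for \<open>(S\<^sub>1, C\<^sub>2, S\<^sub>N)\<close>, both triples satisfy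
\<open>L\<^sub>- W = U\<close>, \<open>L\<^sub>+ U = W + Q N\<close>; they are coupled only through the transport equations. The argument is
a contraction for the weighted size \<open>m\<close> of \<open>U\<close>, defined by \<open>|U x| \<le> m (1 + |x|)\<close>.

Smallness of \<open>N\<close>: the sums and differences of the \<open>N\<close>- and \<open>V\<close>-components rotate with a speed of order
\<open>\<surd>\<omega>\<close> and are driven by \<open>Q U\<close> times a factor of the same order. As they vanish at infinity, undoing the
rotation gives \<open>|N|, |V| = O(\<surd>\<omega> m)\<close> (\<open>rotating_pair_bound\<close>).

A priori estimate: the system \<open>L\<^sub>- W = U\<close>, \<open>L\<^sub>+ U = W + Q N\<close> has four explicit homogeneous solutions,
and the Wronskians with them recover \<open>U\<close>. Their derivatives are multiples of \<open>Q N\<close>, so \<open>U\<close> stays within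
\<open>O(sup |N|) (1 + |x|)\<close> of a multiple \<open>a (1 - Q\<^sup>2)\<close> of the resonance (\<open>near_resonance\<close>). Because
\<open>\<integral> Q\<^sup>2 (1 - Q\<^sup>2) = -4/3 \<noteq> 0\<close>, the coefficient \<open>a\<close> is controlled by \<open>\<integral> Q\<^sup>2 U\<close> (\<open>U_estimate\<close>).

The decisive identity is \<open>\<integral> Q (N + 2 Q U) = 0\<close> (\<open>averaged_source_zero\<close>), which makes \<open>\<integral> Q\<^sup>2 U\<close> as small
as \<open>N\<close>. Two exact pairings start it. Pairing with the resonance gives \<open>\<integral> Q (1 - Q\<^sup>2) N = 0\<close>, that
is \<open>\<integral> Q'' N = 0\<close>. Pairing with \<open>(tanh, tanh)\<close>, which satisfies \<open>L\<^sub>- tanh = tanh\<close> and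
\<open>L\<^sub>+ tanh = tanh + 2 Q Q'\<close>, gives \<open>\<integral> Q' (N + 2 Q U) = 0\<close>. The source \<open>N + 2 Q U\<close> is a multiple of
\<open>V' - \<beta> N'\<close> for the other trigonometric component, so integration by parts with the weights
\<open>Q, Q', Q''\<close> turns these relations into the identity. Together, \<open>|U x| \<le> m (1 + |x|)\<close> implies the same
bound with \<open>m / 2\<close> once \<open>\<surd>\<omega>\<close> is small compared with \<open>1 - \<beta>\<^sup>2\<close>, and iteration gives \<open>U = 0\<close>
(\<open>no_classical_solution\<close>).

All this concerns classical solutions. The du Bois-Reymond lemma shows that each of the eight functions agrees
almost everywhere with a bounded continuous primitive of its weak derivative; the equations then make
these representatives classical solutions, and square integrability of the derivatives makes the
required boundary terms vanish. The numerical constants below are not optimized.\<close>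

section \<open>Smooth functions and test functions\<close>

definition smooth :: "(real \<Rightarrow> real) \<Rightarrow> bool" where
  "smooth f \<longleftrightarrow> (\<forall>k x. (deriv ^^ k) f differentiable (at x))"

text \<open>Computing the iterated derivatives of a product or of \<open>exp (- 1 / x)\<close> one by one needs closed formulas; it is
easier to exhibit a set of differentiable functions that is closed under \<open>deriv\<close>.\<close>
lemma smooth_coinduct:
  assumes "f \<in> S" and "\<And>g x. g \<in> S \<Longrightarrow> g differentiable (at x)" and "\<And>g. g \<in> S \<Longrightarrow> deriv g \<in> S"
  shows "smooth f"
proof -
  have "(deriv ^^ k) f \<in> S" for k
    by (induction k) (use assms in auto)
  then show ?thesis
    using assms(2) by (auto simp: smooth_def)
qed

lemma smooth_differentiable: "smooth f \<Longrightarrow> f differentiable (at x)"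
  unfolding smooth_def by (metis funpow_0)

lemma smooth_DERIV: "smooth f \<Longrightarrow> DERIV f x :> deriv f x"
  using smooth_differentiable DERIV_deriv_iff_real_differentiable by blast

lemma smooth_deriv: "smooth f \<Longrightarrow> smooth (deriv f)"
  unfolding smooth_def by (metis funpow_Suc_right o_apply)

lemma smooth_antideriv:
  assumes "\<And>x. DERIV F x :> f x" and "smooth f"
  shows "smooth F"
proof -
  have d: "deriv F = f"
    using assms(1) by (auto intro!: ext DERIV_imp_deriv)
  have "(deriv ^^ k) F differentiable (at x)" for k x
  proof (cases k)
    case 0
    then show ?thesis using assms(1) real_differentiable_def by auto
  next
    case (Suc n)
    then show ?thesis using assms(2) d by (simp only: funpow_Suc_right o_apply smooth_def)
  qed
  then show ?thesis by (simp add: smooth_def)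
qed

lemma smooth_const: "smooth (\<lambda>x. c)"
  by (rule smooth_coinduct[where S = "range (\<lambda>c x. c)"]) auto

lemma smooth_add:
  assumes "smooth f" "smooth g"
  shows "smooth (\<lambda>x. f x + g x)"
proof (rule smooth_coinduct[where S = "{h. \<exists>f g. smooth f \<and> smooth g \<and> h = (\<lambda>x. f x + g x)}"], goal_cases)
  case 1
  show ?case using assms by blast
next
  case (2 h x)
  then show ?case using smooth_differentiable by (auto intro: differentiable_add)
next
  case (3 h)
  then obtain f g where fg: "smooth f" "smooth g" "h = (\<lambda>x. f x + g x)" by blast
  have "deriv h = (\<lambda>x. deriv f x + deriv g x)"
    unfolding fg by (intro ext DERIV_imp_deriv DERIV_add smooth_DERIV fg)
  then show ?case using fg smooth_deriv by blast
qed

text \<open>By the Leibniz rule, derivatives of products stay among the finite sums of products.\<close>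
inductive_set sum_prods :: "(real \<Rightarrow> real) set" where
  prod: "smooth f \<Longrightarrow> smooth g \<Longrightarrow> (\<lambda>x. f x * g x) \<in> sum_prods"
| sum: "f \<in> sum_prods \<Longrightarrow> g \<in> sum_prods \<Longrightarrow> (\<lambda>x. f x + g x) \<in> sum_prods"

lemma smooth_mult:
  assumes "smooth f" "smooth g"
  shows "smooth (\<lambda>x. f x * g x)"
proof (rule smooth_coinduct)
  show "(\<lambda>x. f x * g x) \<in> sum_prods"
    using assms by (rule sum_prods.prod)
  have "(\<forall>x. h differentiable (at x)) \<and> deriv h \<in> sum_prods" if "h \<in> sum_prods" for h
    using that
  proof induction
    case (prod f g)
    then have "DERIV (\<lambda>x. f x * g x) x :> deriv f x * g x + f x * deriv g x" for x
      using DERIV_mult[of f "deriv f x" x UNIV g "deriv g x"] smooth_DERIV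
      by (simp add: mult.commute)
    moreover from this have "deriv (\<lambda>x. f x * g x) = (\<lambda>x. deriv f x * g x + f x * deriv g x)"
      by (intro ext DERIV_imp_deriv)
    moreover have "\<dots> \<in> sum_prods"
      using prod by (intro sum_prods.intros smooth_deriv)
    ultimately show ?case
      using real_differentiable_def by auto
  next
    case (sum f g)
    then have "DERIV (\<lambda>x. f x + g x) x :> deriv f x + deriv g x" for x
      using DERIV_deriv_iff_real_differentiable by (intro DERIV_add) blast+
    moreover from this have "deriv (\<lambda>x. f x + g x) = (\<lambda>x. deriv f x + deriv g x)"
      by (intro ext DERIV_imp_deriv)
    moreover have "\<dots> \<in> sum_prods"
      using sum by (intro sum_prods.intros) auto
    ultimately show ?case
      using real_differentiable_def by auto
  qed
  then show "\<And>g x. g \<in> sum_prods \<Longrightarrow> g differentiable (at x)"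
    and "\<And>g. g \<in> sum_prods \<Longrightarrow> deriv g \<in> sum_prods"
    by auto
qed

lemma smooth_power: "smooth f \<Longrightarrow> smooth (\<lambda>x. f x ^ n)"
  by (induction n) (auto intro: smooth_const smooth_mult)

lemma smooth_diff: "smooth f \<Longrightarrow> smooth g \<Longrightarrow> smooth (\<lambda>x. f x - g x)"
  using smooth_add[of f "\<lambda>x. (-1) * g x"] smooth_mult[of "\<lambda>x. -1" g] smooth_const[of "-1"]
  by simp

lemma smooth_affine:
  assumes "smooth f"
  shows "smooth (\<lambda>x. f (a * x + b))"
proof (rule smooth_coinduct[where S = "{h. \<exists>g c. smooth g \<and> h = (\<lambda>x. c * g (a * x + b))}"], goal_cases)
  case 1
  show ?case using assms by (intro CollectI exI[of _ f] exI[of _ 1]) auto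
next
  case (2 h x)
  then obtain g c where g: "smooth g" and h: "h = (\<lambda>x. c * g (a * x + b))" by blast
  have "DERIV h x :> c * (deriv g (a * x + b) * a)"
    unfolding h by (intro DERIV_cmult DERIV_chain2[OF smooth_DERIV[OF g]]) (auto intro!: derivative_eq_intros)
  then show ?case using real_differentiable_def by auto
next
  case (3 h)
  then obtain g c where g: "smooth g" and h: "h = (\<lambda>x. c * g (a * x + b))" by blast
  have "DERIV h x :> c * (deriv g (a * x + b) * a)" for x
    unfolding h by (intro DERIV_cmult DERIV_chain2[OF smooth_DERIV[OF g]]) (auto intro!: derivative_eq_intros)
  then have "deriv h = (\<lambda>x. (c * a) * deriv g (a * x + b))"
    by (intro ext) (simp add: DERIV_imp_deriv mult_ac)
  then show ?case using smooth_deriv[OF g] by blast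
qed

text \<open>The polynomial in \<open>1 / x\<close> makes this family closed under differentiation, so that its member for \<open>p = 1\<close>, the
usual \<open>exp (- 1 / x)\<close>, is smooth.\<close>
definition flat :: "real poly \<Rightarrow> real \<Rightarrow> real" where
  "flat p x = (if x > 0 then poly p (1 / x) * exp (- (1 / x)) else 0)"

lemma poly_exp_tendsto_0: "((\<lambda>t. poly p t * exp (- t)) \<longlongrightarrow> (0::real)) at_top"
proof -
  have "((\<lambda>t. \<Sum>i\<le>degree p. coeff p i * (t ^ i / exp t)) \<longlongrightarrow> (\<Sum>i\<le>degree p. coeff p i * 0)) at_top"
    by (intro tendsto_intros tendsto_power_div_exp_0)
  moreover have "(\<lambda>t. \<Sum>i\<le>degree p. coeff p i * (t ^ i / exp t)) = (\<lambda>t. poly p t * exp (- t))"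
    by (simp add: poly_altdef sum_distrib_right exp_minus divide_inverse mult.assoc)
  ultimately show ?thesis by simp
qed

lemma flat_DERIV: "DERIV (flat p) x :> flat ((p - pderiv p) * [:0, 0, 1:]) x"
proof -
  consider "x > 0" | "x < 0" | "x = 0" by linarith
  then show ?thesis
  proof cases
    case 1
    have "DERIV (\<lambda>x. poly p (1 / x) * exp (- (1 / x))) x :> flat ((p - pderiv p) * [:0, 0, 1:]) x"
      using 1 by (auto intro!: derivative_eq_intros simp: flat_def field_simps power2_eq_square)
    moreover have "eventually (\<lambda>y. flat p y = poly p (1 / y) * exp (- (1 / y))) (nhds x)"
      using eventually_nhds_in_open[of "{0<..}" x] 1
      by (auto elim!: eventually_mono simp: flat_def)
    ultimately show ?thesis
      by (subst DERIV_cong_ev[OF refl _ refl])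
  next
    case 2
    have "eventually (\<lambda>y. flat p y = 0) (nhds x)"
      using eventually_nhds_in_open[of "{..<0}" x] 2
      by (auto elim!: eventually_mono simp: flat_def)
    then show ?thesis
      using 2 by (subst DERIV_cong_ev[OF refl _ refl, of _ "\<lambda>_. 0"]) (auto simp: flat_def)
  next
    case 3
    have "((\<lambda>h. poly (p * [:0, 1:]) (inverse h) * exp (- inverse h)) \<longlongrightarrow> 0) (at_right (0::real))"
      by (rule filterlim_compose[OF poly_exp_tendsto_0 filterlim_inverse_at_top_right])
    then have R: "((\<lambda>h. flat p h / h) \<longlongrightarrow> 0) (at_right 0)"
      by (rule Lim_transform_eventually)
         (auto simp: eventually_at_right_less flat_def field_simps intro!: eventually_mono[OF eventually_at_right_less[of 0]])
    have L: "((\<lambda>h. flat p h / h) \<longlongrightarrow> 0) (at_left 0)"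
      by (rule Lim_transform_eventually[OF tendsto_const])
         (auto simp: eventually_at_filter flat_def)
    from L R have "((\<lambda>h. flat p h / h) \<longlongrightarrow> 0) (at 0)"
      using filterlim_split_at by blast
    then show ?thesis
      using 3 by (simp add: DERIV_def flat_def)
  qed
qed

lemma smooth_flat: "smooth (flat p)"
proof (rule smooth_coinduct[where S = "range flat"])
  show "flat p \<in> range flat" by simp
  show "\<And>g x. g \<in> range flat \<Longrightarrow> g differentiable at x"
    using flat_DERIV real_differentiable_def by blast
  show "\<And>g. g \<in> range flat \<Longrightarrow> deriv g \<in> range flat"
  proof -
    fix g :: "real \<Rightarrow> real" assume "g \<in> range flat"
    then obtain p where g: "g = flat p" by blast
    have "deriv g = flat ((p - pderiv p) * [:0, 0, 1:])"
      unfolding g by (intro ext DERIV_imp_deriv flat_DERIV)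
    then show "deriv g \<in> range flat" by blast
  qed
qed

definition bump :: "real \<Rightarrow> real \<Rightarrow> real \<Rightarrow> real" where
  "bump a b x = flat 1 (x - a) * flat 1 (b - x)"

lemma smooth_bump: "smooth (bump a b)"
proof -
  have "smooth (\<lambda>x. flat 1 (1 * x + (- a)) * flat 1 ((- 1) * x + b))"
    by (intro smooth_mult smooth_affine smooth_flat)
  then show ?thesis by (simp add: bump_def[abs_def])
qed

lemma bump_pos: "a < x \<Longrightarrow> x < b \<Longrightarrow> 0 < bump a b x"
  by (simp add: bump_def flat_def)

lemma bump_zero: "\<not> (a < x \<and> x < b) \<Longrightarrow> bump a b x = 0"
  by (auto simp: bump_def flat_def)

lemma bump_range: "0 \<le> bump a b x" "bump a b x < 1"
proof -
  have "0 \<le> flat 1 t" "flat 1 t < 1" for t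
    by (auto simp: flat_def)
  then show "0 \<le> bump a b x" "bump a b x < 1"
    unfolding bump_def by (auto intro: mult_strict_mono[of _ 1 _ 1, simplified] mult_le_one)
       (metis less_eq_real_def mult_strict_mono mult_1 zero_less_one)
qed

text \<open>A radius is more convenient for integration than compactness of the closed support.\<close>
lemma test_fun_iff: "test_fun \<phi> \<longleftrightarrow> smooth \<phi> \<and> (\<exists>R>0. \<forall>x. R < \<bar>x\<bar> \<longrightarrow> \<phi> x = 0)"
proof -
  have "compact (closure {x. \<phi> x \<noteq> 0}) \<longleftrightarrow> (\<exists>R>0. \<forall>x. R < \<bar>x\<bar> \<longrightarrow> \<phi> x = 0)"
  proof -
    have "compact (closure {x. \<phi> x \<noteq> 0}) \<longleftrightarrow> bounded {x. \<phi> x \<noteq> 0}"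
      by simp
    also have "\<dots> \<longleftrightarrow> (\<exists>R>0. \<forall>x. R < \<bar>x\<bar> \<longrightarrow> \<phi> x = 0)"
      unfolding bounded_pos by (auto simp: not_less) (meson not_less)+
    finally show ?thesis .
  qed
  then show ?thesis by (simp add: test_fun_def smooth_def)
qed

section \<open>The du Bois-Reymond lemma\<close>

lemma test_fun_smooth: "test_fun \<phi> \<Longrightarrow> smooth \<phi>"
  by (simp add: test_fun_iff)

lemma smooth_continuous: "smooth f \<Longrightarrow> continuous_on A f"
  by (meson DERIV_continuous_on has_field_derivative_at_within smooth_DERIV)

lemma test_fun_deriv:
  assumes "test_fun \<phi>"
  shows "test_fun (deriv \<phi>)"
proof -
  obtain R where R: "R > 0" "\<And>x. R < \<bar>x\<bar> \<Longrightarrow> \<phi> x = 0"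
    using assms by (auto simp: test_fun_iff)
  have "deriv \<phi> x = 0" if x: "R < \<bar>x\<bar>" for x
  proof (rule DERIV_imp_deriv)
    have "open {x. R < \<bar>x::real\<bar>}"
      by (intro open_Collect_less continuous_intros)
    then have "eventually (\<lambda>y. \<phi> y = 0) (nhds x)"
      using eventually_nhds_in_open[of "{x. R < \<bar>x\<bar>}" x] x R
      by (auto elim!: eventually_mono)
    then show "DERIV \<phi> x :> 0"
      by (subst DERIV_cong_ev[OF refl _ refl, of _ "\<lambda>_. 0"]) auto
  qed
  then show ?thesis
    using R(1) smooth_deriv[OF test_fun_smooth[OF assms]] by (auto simp: test_fun_iff)
qed

lemma test_fun_diff_scaled:
  assumes "test_fun \<phi>" "test_fun \<eta>"
  shows "test_fun (\<lambda>x. \<phi> x - c * \<eta> x)"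
proof -
  obtain R R' where "R > 0" "\<And>x. R < \<bar>x\<bar> \<Longrightarrow> \<phi> x = 0" "\<And>x. R' < \<bar>x\<bar> \<Longrightarrow> \<eta> x = 0"
    using assms by (auto simp: test_fun_iff)
  then have "max R R' > 0 \<and> (\<forall>x. max R R' < \<bar>x\<bar> \<longrightarrow> \<phi> x - c * \<eta> x = 0)"
    by auto
  moreover have "smooth (\<lambda>x. \<phi> x - c * \<eta> x)"
    by (intro smooth_diff smooth_mult smooth_const test_fun_smooth assms)
  ultimately show ?thesis
    unfolding test_fun_iff by blast
qed

definition loc_integrable :: "(real \<Rightarrow> real) \<Rightarrow> bool" where
  "loc_integrable f \<longleftrightarrow> f \<in> borel_measurable lebesgue \<and> (\<forall>a b. f absolutely_integrable_on {a..b})"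

lemma loc_integrable_continuous:
  assumes "continuous_on UNIV f"
  shows "loc_integrable f"
proof -
  have "f \<in> borel_measurable lebesgue"
    using borel_measurable_continuous_onI[OF assms] by (simp add: measurable_completion)
  moreover have "f absolutely_integrable_on {a..b}" for a b
    by (intro absolutely_integrable_continuous_real continuous_on_subset[OF assms]) auto
  ultimately show ?thesis by (simp add: loc_integrable_def)
qed

lemma loc_integrable_diff: "loc_integrable f \<Longrightarrow> loc_integrable g \<Longrightarrow> loc_integrable (\<lambda>x. f x - g x)"
  by (auto simp: loc_integrable_def)

lemma loc_integrable_mult_continuous:
  assumes f: "loc_integrable f" and g: "continuous_on UNIV g"
  shows "loc_integrable (\<lambda>x. g x * f x)"
proof -
  have m: "g \<in> borel_measurable lebesgue"
    using loc_integrable_continuous[OF g] by (simp add: loc_integrable_def)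
  have "(\<lambda>x. g x * f x) absolutely_integrable_on {a..b}" for a b
  proof (rule absolutely_integrable_bounded_measurable_product_real)
    show "g \<in> borel_measurable (lebesgue_on {a..b})"
      using m by (simp add: measurable_restrict_space1)
    show "bounded (g ` {a..b})"
      by (intro compact_imp_bounded compact_continuous_image continuous_on_subset[OF g]) auto
    show "f absolutely_integrable_on {a..b}"
      using f by (simp add: loc_integrable_def)
  qed auto
  moreover have "(\<lambda>x. g x * f x) \<in> borel_measurable lebesgue"
    using f m by (auto simp: loc_integrable_def intro: borel_measurable_times)
  ultimately show ?thesis
    by (simp add: loc_integrable_def)
qed

lemma loc_integrable_integrable_on: "loc_integrable f \<Longrightarrow> f integrable_on {a..b}"
  unfolding loc_integrable_def using set_lebesgue_integral_eq_integral(1) by blast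

lemma integrable_mult_test_fun:
  assumes f: "loc_integrable f" and \<phi>: "test_fun \<phi>"
  shows "integrable lebesgue (\<lambda>x. f x * \<phi> x)"
proof -
  obtain R where R: "\<And>x. R < \<bar>x\<bar> \<Longrightarrow> \<phi> x = 0"
    using \<phi> by (auto simp: test_fun_iff)
  have "loc_integrable (\<lambda>x. \<phi> x * f x)"
    by (intro loc_integrable_mult_continuous f smooth_continuous test_fun_smooth \<phi>)
  then have "integrable lebesgue (\<lambda>x. indicator {-R..R} x *\<^sub>R (\<phi> x * f x))"
    by (simp add: loc_integrable_def set_integrable_def)
  moreover have "(\<lambda>x. indicator {-R..R} x *\<^sub>R (\<phi> x * f x)) = (\<lambda>x. f x * \<phi> x)"
  proof
    fix x show "indicator {-R..R} x *\<^sub>R (\<phi> x * f x) = f x * \<phi> x"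
      using R[of x] by (cases "R < \<bar>x\<bar>") (auto simp: indicator_def)
  qed
  ultimately show ?thesis by simp
qed

lemma L2_loc_integrable:
  assumes "g \<in> L2"
  shows "loc_integrable g"
proof -
  have g: "g \<in> borel_measurable lebesgue" "integrable lebesgue (\<lambda>y. (g y)\<^sup>2)"
    using assms by (auto simp: L2_def)
  have "g absolutely_integrable_on {a..b}" for a b
    unfolding set_integrable_def
  proof (rule Bochner_Integration.integrable_bound)
    show "integrable lebesgue (\<lambda>y. (g y)\<^sup>2 + indicator {a..b} y)"
      using g(2) by (intro Bochner_Integration.integrable_add) (auto intro!: integrable_real_indicator simp: emeasure_lborel_Icc_eq)
    show "(\<lambda>x. indicator {a..b} x *\<^sub>R g x) \<in> borel_measurable lebesgue"
      using g(1) by (intro borel_measurable_scaleR borel_measurable_indicator) auto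
    have "\<bar>t\<bar> \<le> t\<^sup>2 + 1" for t :: real
      using zero_le_power2[of "\<bar>t\<bar> - 1"] by (simp add: power2_eq_square algebra_simps)
    then show "AE x in lebesgue. norm (indicator {a..b} x *\<^sub>R g x) \<le> norm ((g x)\<^sup>2 + indicator {a..b} x)"
      by (auto simp: indicator_def)
  qed
  then show ?thesis using g(1) by (simp add: loc_integrable_def)
qed

lemma Linfty_loc_integrable:
  assumes "f \<in> Linfty"
  shows "loc_integrable f"
proof -
  obtain M where f: "f \<in> borel_measurable lebesgue" "AE y in lebesgue. \<bar>f y\<bar> \<le> M"
    using assms by (auto simp: Linfty_def)
  have "f absolutely_integrable_on {a..b}" for a b
    unfolding set_integrable_def
  proof (rule Bochner_Integration.integrable_bound)
    show "integrable lebesgue (\<lambda>y. M * indicator {a..b} y)"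
      by (auto intro!: integrable_real_indicator simp: emeasure_lborel_Icc_eq)
    show "(\<lambda>x. indicator {a..b} x *\<^sub>R f x) \<in> borel_measurable lebesgue"
      using f(1) by (intro borel_measurable_scaleR borel_measurable_indicator) auto
    show "AE x in lebesgue. norm (indicator {a..b} x *\<^sub>R f x) \<le> norm (M * indicator {a..b} x)"
      using f(2) by eventually_elim (auto simp: indicator_def)
  qed
  then show ?thesis using f(1) by (simp add: loc_integrable_def)
qed

text \<open>The fundamental lemma of the calculus of variations. Test functions approximate the indicator of an
interval from below, so all integrals of \<open>k\<close> over intervals vanish, and the Lebesgue differentiation theorem
gives \<open>k = 0\<close> almost everywhere.\<close>
lemma AE_zero_if_orthogonal_test_fun:
  assumes k: "loc_integrable k" and orth: "\<And>\<phi>. test_fun \<phi> \<Longrightarrow> (\<integral>x. k x * \<phi> x \<partial>lebesgue) = 0"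
  shows "AE x in lebesgue. k x = 0"
proof -
  have zero: "integral {a..b} k = 0" if "a < b" for a b
  proof -
    \<comment> \<open>since the bump is positive exactly on the open interval and less than 1, these smooth functions increase to its indicator\<close>
    define \<phi> where "\<phi> n x = 1 - (1 - bump a b x) ^ n" for n :: nat and x
    have r: "0 \<le> 1 - bump a b x" "1 - bump a b x \<le> 1" for x
      using bump_range[of a b x] by auto
    have test: "test_fun (\<phi> n)" for n
    proof -
      have "\<phi> n x = 0" if "max 1 (max \<bar>a\<bar> \<bar>b\<bar>) < \<bar>x\<bar>" for x
      proof -
        have "bump a b x = 0"
          using that by (intro bump_zero) auto
        then show ?thesis by (simp add: \<phi>_def)
      qed
      moreover have "smooth (\<phi> n)"
        unfolding \<phi>_def[abs_def] by (intro smooth_diff smooth_power smooth_const smooth_bump)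
      ultimately show ?thesis
        unfolding test_fun_iff by (intro conjI exI[of _ "max 1 (max \<bar>a\<bar> \<bar>b\<bar>)"]) auto
    qed
    have "(\<lambda>n. \<integral>x. k x * \<phi> n x \<partial>lebesgue) \<longlonglongrightarrow> (\<integral>x. k x * indicator {a<..<b} x \<partial>lebesgue)"
    proof (rule integral_dominated_convergence[where w = "\<lambda>x. \<bar>indicator {a..b} x *\<^sub>R k x\<bar>"])
      show "integrable lebesgue (\<lambda>x. \<bar>indicator {a..b} x *\<^sub>R k x\<bar>)"
        using k by (intro integrable_abs) (simp add: loc_integrable_def set_integrable_def)
      show "(\<lambda>x. k x * \<phi> n x) \<in> borel_measurable lebesgue" for n
        using integrable_mult_test_fun[OF k test] by blast
      show "(\<lambda>x. k x * indicator {a<..<b} x) \<in> borel_measurable lebesgue"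
        using k by (auto simp: loc_integrable_def intro!: borel_measurable_times borel_measurable_indicator)
      have "(\<lambda>n. \<phi> n x) \<longlonglongrightarrow> indicator {a<..<b} x" for x
      proof (cases "a < x \<and> x < b")
        case True
        then have "(\<lambda>n. 1 - (1 - bump a b x) ^ n) \<longlonglongrightarrow> 1 - 0"
          using bump_pos[of a x b] r[of x] by (intro tendsto_intros LIMSEQ_power_zero) auto
        then show ?thesis using True by (simp add: \<phi>_def)
      next
        case False
        then show ?thesis by (auto simp: \<phi>_def bump_zero)
      qed
      then show "AE x in lebesgue. (\<lambda>n. k x * \<phi> n x) \<longlonglongrightarrow> k x * indicator {a<..<b} x"
        by (intro AE_I2 tendsto_intros)
      have "norm (k x * \<phi> n x) \<le> \<bar>indicator {a..b} x *\<^sub>R k x\<bar>" for x n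
      proof (cases "a < x \<and> x < b")
        case True
        have "\<bar>\<phi> n x\<bar> \<le> 1"
          using r[of x] power_le_one[OF r(1,2), of x n] zero_le_power[OF r(1), of x n]
          by (simp add: \<phi>_def)
        then show ?thesis using True mult_left_le[of "\<bar>\<phi> n x\<bar>" "\<bar>k x\<bar>"] by (simp add: abs_mult)
      qed (auto simp: \<phi>_def bump_zero)
      then show "AE x in lebesgue. norm (k x * \<phi> n x) \<le> \<bar>indicator {a..b} x *\<^sub>R k x\<bar>" for n
        by (intro AE_I2)
    qed
    then have "(\<integral>x. k x * indicator {a<..<b} x \<partial>lebesgue) = 0"
      using orth[OF test] LIMSEQ_unique[OF _ tendsto_const] by simp
    moreover have "k absolutely_integrable_on {a<..<b}"
    proof (rule set_integrable_subset)
      show "k absolutely_integrable_on {a..b}"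
        using k by (simp add: loc_integrable_def)
    qed auto
    ultimately have "integral {a<..<b} k = 0"
      using set_lebesgue_integral_eq_integral(2)[of "{a<..<b}" k]
      by (simp add: set_lebesgue_integral_def mult.commute)
    then show ?thesis
      using integral_open_interval_real[of a b k] by simp
  qed
  obtain N where N: "negligible N" "\<And>x e. x \<notin> N \<Longrightarrow> 0 < e \<Longrightarrow> \<exists>d>0. \<forall>h. 0 < h \<and> h < d \<longrightarrow>
      norm (integral (cbox x (x + h *\<^sub>R One)) k /\<^sub>R h ^ DIM(real) - k x) < e"
    using integrable_ccontinuous_explicit[of k] loc_integrable_integrable_on[OF k]
    by (metis box_real(2))
  have "k x = 0" if xN: "x \<notin> N" for x
  proof (rule ccontr)
    assume "k x \<noteq> 0"
    then obtain d where d: "d > 0" "\<And>h. 0 < h \<and> h < d \<Longrightarrow>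
        norm (integral (cbox x (x + h *\<^sub>R One)) k /\<^sub>R h ^ DIM(real) - k x) < \<bar>k x\<bar>"
      using N(2)[OF xN, of "\<bar>k x\<bar>"] by auto
    from d(2)[of "d/2"] d(1) zero[of x "x + d/2"] show False
      by simp
  qed
  moreover have "AE x in lebesgue. x \<notin> N"
    using N(1) by (intro AE_not_in) (simp add: negligible_iff_null_sets)
  ultimately show ?thesis by (auto elim!: eventually_mono)
qed

lemma primitive_exists:
  assumes g: "loc_integrable g"
  obtains F where "continuous_on UNIV F" "\<And>a b. a \<le> b \<Longrightarrow> F b - F a = integral {a..b} g"
proof
  note int = loc_integrable_integrable_on[OF g]
  \<comment> \<open>one of the two intervals is empty or a point, so this is the signed integral from 0\<close>
  define F where "F x = integral {0..x} g - integral {x..0} g" for x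
  have neg: "integral {x..0} g = 0" if "0 \<le> x" for x
    using that by (cases "x = 0") auto
  have pos: "integral {0..x} g = 0" if "x \<le> 0" for x
    using that by (cases "x = 0") auto
  show F: "F b - F a = integral {a..b} g" if "a \<le> b" for a b
  proof -
    consider "0 \<le> a" | "a < 0" "0 \<le> b" | "b < 0" by linarith
    then show ?thesis
    proof cases
      case 1
      then show ?thesis
        using that Henstock_Kurzweil_Integration.integral_combine[OF 1 that int] by (simp add: F_def neg pos)
    next
      case 2
      then show ?thesis
        using Henstock_Kurzweil_Integration.integral_combine[of a 0 b, OF _ _ int] by (simp add: F_def neg pos)
    next
      case 3
      then show ?thesis
        using that Henstock_Kurzweil_Integration.integral_combine[OF that _ int, of 0] by (simp add: F_def neg pos)
    qed
  qed
  have "isCont F x" for x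
  proof -
    have "continuous_on {x-1..x+1} (\<lambda>y. F (x-1) + integral {x-1..y} g)"
      by (intro continuous_intros indefinite_integral_continuous_1 int)
    moreover have "F (x-1) + integral {x-1..y} g = F y" if "y \<in> {x-1..x+1}" for y
      using F[of "x-1" y] that by auto
    ultimately have "continuous_on {x-1..x+1} F"
      by (rule continuous_on_eq)
    then show ?thesis
      by (rule continuous_on_interior) auto
  qed
  then show "continuous_on UNIV F"
    by (simp add: continuous_on_eq_continuous_at)
qed

text \<open>Integration by parts without a pointwise derivative of \<open>F\<close>: both sides are the double integral of
\<open>g s * deriv \<phi> x\<close> over \<open>s \<le> x\<close>, evaluated in the two orders.\<close>
lemma primitive_by_parts:
  assumes g: "loc_integrable g"
    and Fg: "\<And>a b. a \<le> b \<Longrightarrow> F b - F a = integral {a..b} g"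
    and \<phi>: "test_fun \<phi>"
  shows "(\<integral>x. F x * deriv \<phi> x \<partial>lebesgue) = - (\<integral>x. g x * \<phi> x \<partial>lebesgue)"
proof -
  have \<psi>: "test_fun (deriv \<phi>)" by (rule test_fun_deriv[OF \<phi>])
  obtain R1 where R1: "R1 > 0" "\<And>x. R1 < \<bar>x\<bar> \<Longrightarrow> \<phi> x = 0"
    using \<phi> by (auto simp: test_fun_iff)
  obtain R2 where R2: "R2 > 0" "\<And>x. R2 < \<bar>x\<bar> \<Longrightarrow> deriv \<phi> x = 0"
    using \<psi> by (auto simp: test_fun_iff)
  define R where "R = max R1 R2 + 1"
  have R: "R > 0" "\<And>x. R \<le> \<bar>x\<bar> \<Longrightarrow> \<phi> x = 0" "\<And>x. R \<le> \<bar>x\<bar> \<Longrightarrow> deriv \<phi> x = 0"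
    using R1 R2 by (auto simp: R_def)
  \<comment> \<open>truncation makes \<open>g\<close> globally integrable and changes nothing on the support of \<open>\<phi>\<close>\<close>
  define G where "G s = indicator {-R..R} s * g s" for s
  have G: "integrable lebesgue G"
    using g by (simp add: G_def[abs_def] loc_integrable_def set_integrable_def)
  have d: "integrable lebesgue (deriv \<phi>)"
    using integrable_mult_test_fun[OF loc_integrable_continuous[of "\<lambda>_. 1"] \<psi>] by simp
  have tail: "(\<integral>x. indicator {..x} s * deriv \<phi> x \<partial>lebesgue) = - \<phi> s" if "\<bar>s\<bar> \<le> R" for s
  proof -
    have "(\<lambda>x. indicator {..x} s * deriv \<phi> x) = (\<lambda>x. indicator {s..R} x *\<^sub>R deriv \<phi> x)"
      using R by (intro ext) (auto simp: indicator_def)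
    moreover have "(LINT x:{s..R}|lebesgue. deriv \<phi> x) = integral {s..R} (deriv \<phi>)"
      by (intro set_lebesgue_integral_eq_integral absolutely_integrable_continuous_real
            smooth_continuous test_fun_smooth \<psi>)
    moreover have "(deriv \<phi> has_integral (\<phi> R - \<phi> s)) {s..R}"
      using that smooth_DERIV[OF test_fun_smooth[OF \<phi>]]
      by (intro fundamental_theorem_of_calculus)
         (auto simp: has_real_derivative_iff_has_vector_derivative[symmetric] has_field_derivative_at_within)
    ultimately show ?thesis
      using R(2)[of R] R(1) by (simp add: set_lebesgue_integral_def integral_unique)
  qed
  have head: "(\<integral>s. G s * indicator {..x} s \<partial>lebesgue) = F x - F (- R)" if "\<bar>x\<bar> \<le> R" for x
  proof -
    have "(\<lambda>s. G s * indicator {..x} s) = (\<lambda>s. indicator {-R..x} s *\<^sub>R g s)"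
      using that by (intro ext) (auto simp: indicator_def G_def)
    moreover have "(LINT s:{-R..x}|lebesgue. g s) = integral {-R..x} g"
      using g by (intro set_lebesgue_integral_eq_integral) (auto simp: loc_integrable_def)
    ultimately show ?thesis
      using Fg[of "-R" x] that by (simp add: set_lebesgue_integral_def)
  qed
  have "sigma_finite_measure (lebesgue :: real measure)"
  proof (standard, intro exI conjI ballI)
    show "countable (range (\<lambda>n::nat. {- real n..real n}))" by simp
    have "x \<in> (\<Union>n::nat. {- real n..real n})" for x
      using real_arch_simple[of "\<bar>x\<bar>"] by (auto simp: abs_le_iff minus_le_iff)
    then show "\<Union> (range (\<lambda>n::nat. {- real n..real n})) = space lebesgue" by auto
  qed (auto simp: emeasure_lborel_Icc_eq)
  then interpret pair_sigma_finite "lebesgue :: real measure" "lebesgue :: real measure"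
    by (simp add: pair_sigma_finite_def)
  define h where "h x s = G s * indicator {..x} s * deriv \<phi> x" for x s :: real
  have id: "(\<lambda>x::real. x) \<in> borel_measurable lebesgue"
    by (rule measurable_completion) simp
  have h_meas: "case_prod h \<in> borel_measurable (lebesgue \<Otimes>\<^sub>M lebesgue)"
  proof -
    have [measurable]: "fst \<in> borel_measurable (lebesgue \<Otimes>\<^sub>M lebesgue :: (real \<times> real) measure)"
      "snd \<in> borel_measurable (lebesgue \<Otimes>\<^sub>M lebesgue :: (real \<times> real) measure)"
      by (rule measurable_compose[OF measurable_fst id], rule measurable_compose[OF measurable_snd id])
    have [measurable]: "G \<in> borel_measurable lebesgue" "deriv \<phi> \<in> borel_measurable lebesgue"
      using G d by auto
    have "case_prod h = (\<lambda>p. (if snd p \<le> fst p then G (snd p) * deriv \<phi> (fst p) else 0))"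
      by (auto simp: h_def indicator_def)
    also have "\<dots> \<in> borel_measurable (lebesgue \<Otimes>\<^sub>M lebesgue)"
      by measurable
    finally show ?thesis .
  qed
  have h_int: "integrable (lebesgue \<Otimes>\<^sub>M lebesgue) (case_prod h)"
  proof (rule Fubini_integrable[OF h_meas])
    show "AE x in lebesgue. integrable lebesgue (\<lambda>y. case_prod h (x, y))"
    proof (intro AE_I2)
      fix x :: real
      have "integrable lebesgue (\<lambda>s. deriv \<phi> x * (indicator {..x} s *\<^sub>R G s))"
        using G by (intro integrable_mult_right integrable_mult_indicator) auto
      then show "integrable lebesgue (\<lambda>y. case_prod h (x, y))"
        by (simp add: h_def mult_ac)
    qed
    have eq: "(\<integral>y. norm (case_prod h (x, y)) \<partial>lebesgue)
        = \<bar>deriv \<phi> x\<bar> * (\<integral>s. \<bar>indicator {..x} s * G s\<bar> \<partial>lebesgue)" for x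
      by (auto simp: h_def abs_mult mult_ac simp flip: integral_mult_right_zero)
    have meas: "(\<lambda>x. \<integral>y. norm (case_prod h (x, y)) \<partial>lebesgue) \<in> borel_measurable lebesgue"
      using h_meas by measurable
    show "integrable lebesgue (\<lambda>x. \<integral>y. norm (case_prod h (x, y)) \<partial>lebesgue)"
    proof (rule Bochner_Integration.integrable_bound[OF _ meas])
      show "integrable lebesgue (\<lambda>x. deriv \<phi> x * (\<integral>s. \<bar>G s\<bar> \<partial>lebesgue))"
        using d by simp
      have "(\<integral>s. \<bar>indicator {..x} s * G s\<bar> \<partial>lebesgue) \<le> (\<integral>s. \<bar>G s\<bar> \<partial>lebesgue)" for x
      proof (rule integral_mono)
        show "integrable lebesgue (\<lambda>s. \<bar>indicator {..x} s * G s\<bar>)"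
          using integrable_mult_indicator[of "{..x}" lebesgue G] G by simp
      qed (use G in \<open>auto simp: indicator_def\<close>)
      then show "AE x in lebesgue. norm (\<integral>y. norm (case_prod h (x, y)) \<partial>lebesgue)
          \<le> norm (deriv \<phi> x * (\<integral>s. \<bar>G s\<bar> \<partial>lebesgue))"
        unfolding eq by (intro AE_I2) (simp add: abs_mult mult_left_mono)
    qed
  qed
  have "(\<integral>x. F x * deriv \<phi> x \<partial>lebesgue)
      = (\<integral>x. (\<integral>s. h x s \<partial>lebesgue) + F (- R) * deriv \<phi> x \<partial>lebesgue)"
  proof (rule Bochner_Integration.integral_cong[OF refl])
    fix x :: real
    have "(\<integral>s. h x s \<partial>lebesgue) = (F x - F (- R)) * deriv \<phi> x"
      using head[of x] R(3)[of x] by (cases "\<bar>x\<bar> \<le> R") (auto simp: h_def)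
    then show "F x * deriv \<phi> x = (\<integral>s. h x s \<partial>lebesgue) + F (- R) * deriv \<phi> x"
      by (simp add: algebra_simps)
  qed
  also have "\<dots> = (\<integral>x. (\<integral>s. h x s \<partial>lebesgue) \<partial>lebesgue) + F (- R) * (\<integral>x. deriv \<phi> x \<partial>lebesgue)"
    using integrable_fst[OF h_int] d by simp
  also have "(\<integral>x. deriv \<phi> x \<partial>lebesgue) = 0"
  proof -
    have "(\<integral>x. deriv \<phi> x \<partial>lebesgue) = (\<integral>x. indicator {..x} (-R) * deriv \<phi> x \<partial>lebesgue)"
      using R by (intro Bochner_Integration.integral_cong) (auto simp: indicator_def)
    then show ?thesis
      using tail[of "-R"] R by simp
  qed
  also have "(\<integral>x. (\<integral>s. h x s \<partial>lebesgue) \<partial>lebesgue) = (\<integral>s. (\<integral>x. h x s \<partial>lebesgue) \<partial>lebesgue)"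
    using Fubini_integral[OF h_int] by simp
  also have "\<dots> = (\<integral>s. - (g s * \<phi> s) \<partial>lebesgue)"
  proof (rule Bochner_Integration.integral_cong[OF refl])
    fix s :: real
    have "(\<integral>x. h x s \<partial>lebesgue) = G s * (\<integral>x. indicator {..x} s * deriv \<phi> x \<partial>lebesgue)"
      by (simp add: h_def mult.assoc)
    then show "(\<integral>x. h x s \<partial>lebesgue) = - (g s * \<phi> s)"
      using tail[of s] R(2)[of s] by (cases "\<bar>s\<bar> \<le> R") (auto simp: G_def indicator_def)
  qed
  finally show ?thesis by simp
qed

text \<open>After subtracting a multiple of a fixed test function of nonzero mean, every test function has mean zero and
is the derivative of a test function; hence \<open>k\<close> minus a constant is orthogonal to all test functions.\<close>
lemma AE_const_if_weak_deriv_zero: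
  assumes k: "loc_integrable k"
    and orth: "\<And>\<phi>. test_fun \<phi> \<Longrightarrow> (\<integral>x. k x * deriv \<phi> x \<partial>lebesgue) = 0"
  shows "\<exists>c. AE x in lebesgue. k x = c"
proof -
  have one: "loc_integrable (\<lambda>_. 1)"
    by (intro loc_integrable_continuous continuous_intros)
  have "\<exists>\<eta>. test_fun \<eta> \<and> (\<integral>x. \<eta> x \<partial>lebesgue) \<noteq> 0"
  proof (rule ccontr)
    assume "\<not> ?thesis"
    then have "AE x::real in lebesgue. (1::real) = 0"
      using AE_zero_if_orthogonal_test_fun[OF one] by simp
    then have "ae_filter lebesgue = (bot :: real filter)"
      by (simp add: eventually_False)
    then show False by (simp add: ae_filter_eq_bot_iff)
  qed
  then obtain \<eta> where \<eta>: "test_fun \<eta>" "(\<integral>x. \<eta> x \<partial>lebesgue) \<noteq> 0" by blast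
  define c where "c = (\<integral>x. k x * \<eta> x \<partial>lebesgue) / (\<integral>x. \<eta> x \<partial>lebesgue)"
  have "(\<integral>x. (k x - c) * \<psi> x \<partial>lebesgue) = 0" if \<psi>: "test_fun \<psi>" for \<psi>
  proof -
    define m where "m = (\<integral>x. \<psi> x \<partial>lebesgue) / (\<integral>x. \<eta> x \<partial>lebesgue)"
    define \<theta> where "\<theta> x = \<psi> x - m * \<eta> x" for x
    have \<theta>: "test_fun \<theta>"
      unfolding \<theta>_def[abs_def] by (rule test_fun_diff_scaled[OF \<psi> \<eta>(1)])
    have i: "integrable lebesgue \<xi>" if "test_fun \<xi>" for \<xi>
      using integrable_mult_test_fun[OF one that] by simp
    have mean: "(\<integral>x. \<theta> x \<partial>lebesgue) = 0"
      using i[OF \<psi>] i[OF \<eta>(1)] \<eta>(2) by (simp add: \<theta>_def m_def)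
    obtain R where R: "R > 0" "\<And>x. R < \<bar>x\<bar> \<Longrightarrow> \<theta> x = 0"
      using \<theta> by (auto simp: test_fun_iff)
    have cont: "continuous_on A \<theta>" for A
      by (intro smooth_continuous test_fun_smooth \<theta>)
    have loc: "loc_integrable \<theta>"
      by (intro loc_integrable_continuous cont)
    obtain P where P: "continuous_on UNIV P" "\<And>a b. a \<le> b \<Longrightarrow> P b - P a = integral {a..b} \<theta>"
      using primitive_exists[OF loc] by blast
    define \<Theta> where "\<Theta> x = P x - P (- R - 1)" for x
    have D: "DERIV \<Theta> x :> \<theta> x" for x
    proof -
      have "((\<lambda>u. integral {x-1..u} \<theta>) has_real_derivative \<theta> x) (at x within {x-1..x+1})"
        by (intro integral_has_real_derivative cont) auto
      then have "((\<lambda>u. \<Theta> (x-1) + integral {x-1..u} \<theta>) has_real_derivative \<theta> x) (at x within {x-1..x+1})"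
        by (auto intro!: derivative_eq_intros)
      then have "(\<Theta> has_real_derivative \<theta> x) (at x within {x-1..x+1})"
      proof (rule has_field_derivative_transform_within[where d = 1])
        fix u assume "u \<in> {x-1..x+1}"
        then show "\<Theta> (x-1) + integral {x-1..u} \<theta> = \<Theta> u"
          using P(2)[of "x-1" u] by (simp add: \<Theta>_def)
      qed auto
      then show ?thesis
        by (simp add: at_within_Icc_at)
    qed
    have "\<Theta> x = 0" if x: "R + 1 < \<bar>x\<bar>" for x
    proof (cases "x > 0")
      case True
      have supp: "indicator {-R-1..x} s *\<^sub>R \<theta> s = \<theta> s" for s
        using R(2)[of s] x True R(1) by (cases "R < \<bar>s\<bar>") (auto simp: indicator_def)
      have "integral {-R-1..x} \<theta> = (LINT s:{-R-1..x}|lebesgue. \<theta> s)"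
        using loc by (simp add: loc_integrable_def set_lebesgue_integral_eq_integral)
      also have "\<dots> = (\<integral>s. \<theta> s \<partial>lebesgue)"
        unfolding set_lebesgue_integral_def supp ..
      finally show ?thesis
        using P(2)[of "-R-1" x] x True R(1) mean by (simp add: \<Theta>_def)
    next
      case False
      have "integral {x..-R-1} \<theta> = integral {x..-R-1} (\<lambda>_. 0)"
        using R by (intro integral_cong) auto
      then show ?thesis
        using P(2)[of x "-R-1"] x False R(1) by (simp add: \<Theta>_def)
    qed
    then have "test_fun \<Theta>"
      unfolding test_fun_iff using smooth_antideriv[OF D test_fun_smooth[OF \<theta>]] R(1)
      by (intro conjI exI[of _ "R+1"]) auto
    moreover have "deriv \<Theta> = \<theta>"
      using D by (auto intro!: DERIV_imp_deriv)
    ultimately have "(\<integral>x. k x * \<theta> x \<partial>lebesgue) = 0"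
      using orth by metis
    moreover have "(\<integral>x. k x * \<theta> x \<partial>lebesgue)
        = (\<integral>x. k x * \<psi> x \<partial>lebesgue) - m * (\<integral>x. k x * \<eta> x \<partial>lebesgue)"
      using integrable_mult_test_fun[OF k \<psi>] integrable_mult_test_fun[OF k \<eta>(1)]
      by (simp add: \<theta>_def right_diff_distrib mult.left_commute[of _ m])
    moreover have "(\<integral>x. (k x - c) * \<psi> x \<partial>lebesgue)
        = (\<integral>x. k x * \<psi> x \<partial>lebesgue) - c * (\<integral>x. \<psi> x \<partial>lebesgue)"
      using integrable_mult_test_fun[OF k \<psi>] i[OF \<psi>]
      by (simp add: left_diff_distrib)
    ultimately show ?thesis
      by (simp add: c_def m_def)
  qed
  then have "AE x in lebesgue. k x - c = 0"
    by (intro AE_zero_if_orthogonal_test_fun loc_integrable_diff k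
        loc_integrable_continuous[OF continuous_on_const])
  then show ?thesis by auto
qed

lemma du_Bois_Reymond:
  assumes f: "loc_integrable f" and g: "loc_integrable g"
    and weak: "\<And>\<phi>. test_fun \<phi> \<Longrightarrow> (\<integral>x. f x * deriv \<phi> x \<partial>lebesgue) = - (\<integral>x. g x * \<phi> x \<partial>lebesgue)"
  obtains F where "continuous_on UNIV F" "AE x in lebesgue. f x = F x"
    "\<And>a b. a \<le> b \<Longrightarrow> F b - F a = integral {a..b} g"
proof -
  obtain P where P: "continuous_on UNIV P" "\<And>a b. a \<le> b \<Longrightarrow> P b - P a = integral {a..b} g"
    using primitive_exists[OF g] by blast
  have locP: "loc_integrable P"
    by (rule loc_integrable_continuous[OF P(1)])
  have "(\<integral>x. (f x - P x) * deriv \<phi> x \<partial>lebesgue) = 0" if "test_fun \<phi>" for \<phi>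
    using weak[OF that] primitive_by_parts[OF g P(2) that]
      integrable_mult_test_fun[OF f test_fun_deriv[OF that]]
      integrable_mult_test_fun[OF locP test_fun_deriv[OF that]]
    by (simp add: left_diff_distrib)
  then obtain c where c: "AE x in lebesgue. f x - P x = c"
    using AE_const_if_weak_deriv_zero[OF loc_integrable_diff[OF f locP]] by blast
  show ?thesis
  proof
    show "continuous_on UNIV (\<lambda>x. P x + c)"
      using P(1) by (intro continuous_intros)
    show "AE x in lebesgue. f x = P x + c"
      using c by eventually_elim simp
    show "\<And>a b. a \<le> b \<Longrightarrow> (P b + c) - (P a + c) = integral {a..b} g"
      using P(2) by simp
  qed
qed

section \<open>Estimates for the soliton profile and comparison on the line\<close>

lemma Q_pos: "0 < Q x"
  by (simp add: Q_def)

lemma Q_sq: "(Q x)\<^sup>2 = 2 * (1 - (tanh x)\<^sup>2)"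
proof -
  have "(cosh x)\<^sup>2 \<noteq> 0" by simp
  then show ?thesis
    using cosh_square_eq[of x] by (simp add: Q_def tanh_def power_divide divide_simps)
qed

lemma Q_DERIV [derivative_intros]:
  assumes "(f has_real_derivative f') (at x within A)"
  shows "((\<lambda>x. Q (f x)) has_real_derivative - tanh (f x) * Q (f x) * f') (at x within A)"
proof -
  have "DERIV Q y :> - tanh y * Q y" for y
    unfolding Q_def[abs_def]
    by (auto intro!: derivative_eq_intros simp: tanh_def field_simps power2_eq_square)
  from DERIV_chain2[OF this assms] show ?thesis .
qed

lemma Q_continuous [continuous_intros]:
  "continuous_on A f \<Longrightarrow> continuous_on A (\<lambda>x. Q (f x))"
  unfolding Q_def by (intro continuous_intros) auto

lemma abs_tanh_le: "\<bar>tanh x\<bar> \<le> (1::real)"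
  using tanh_real_bounds[of x] by (simp add: abs_le_iff)

lemma tanh_sq_le: "(tanh x)\<^sup>2 \<le> (1::real)"
  using power_mono[OF abs_tanh_le[of x], of 2] by simp

text \<open>Three powers leave one for the weight \<open>1 + |x|\<close> and two for the integrable majorant \<open>1 / (1 + x\<^sup>2)\<close>.\<close>
lemma Q_decay: "Q x * (1 + \<bar>x\<bar>) ^ 3 \<le> 108"
proof -
  have "(1 + \<bar>x\<bar>) ^ 3 \<le> (3 * exp (\<bar>x\<bar> / 3)) ^ 3"
    using exp_ge_add_one_self[of "\<bar>x\<bar> / 3"] by (intro power_mono) (simp_all add: field_simps)
  also have "\<dots> = 27 * exp \<bar>x\<bar>"
    by (simp add: power_mult_distrib flip: exp_of_nat_mult)
  also have "exp \<bar>x\<bar> \<le> 2 * cosh x"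
    by (cases "x \<ge> 0") (auto simp: cosh_def)
  finally have "(1 + \<bar>x\<bar>) ^ 3 \<le> 54 * cosh x" by simp
  then have "Q x * (1 + \<bar>x\<bar>) ^ 3 \<le> Q x * (54 * cosh x)"
    using Q_pos[of x] by (intro mult_left_mono) auto
  also have "\<dots> = 54 * sqrt 2"
    by (simp add: Q_def)
  also have "\<dots> \<le> 108"
    using sqrt2_less_2 by simp
  finally show ?thesis .
qed

lemma Q_weight_le: "Q x * (1 + \<bar>x\<bar>) \<le> 108 / (1 + x\<^sup>2)"
proof -
  have "1 + x\<^sup>2 \<le> (1 + \<bar>x\<bar>)\<^sup>2"
    by (simp add: power2_eq_square algebra_simps)
  then have "Q x * (1 + \<bar>x\<bar>) * (1 + x\<^sup>2) \<le> Q x * (1 + \<bar>x\<bar>) * (1 + \<bar>x\<bar>)\<^sup>2"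
    using Q_pos[of x] by (intro mult_left_mono) auto
  also have "\<dots> = Q x * (1 + \<bar>x\<bar>) ^ 3"
    by (simp add: power2_eq_square power3_eq_cube)
  also have "\<dots> \<le> 108" by (rule Q_decay)
  finally show ?thesis
    by (simp add: pos_le_divide_eq add_pos_nonneg)
qed

lemma Q_le_2: "Q x \<le> 2"
proof -
  have "sqrt 2 \<le> 2 * cosh x"
    using sqrt2_less_2 cosh_real_ge_1[of x] by linarith
  then show ?thesis by (simp add: Q_def pos_divide_le_eq)
qed

lemma Q_mult_bound:
  assumes "\<bar>k\<bar> \<le> M * (1 + \<bar>x\<bar>)"
  shows "\<bar>Q x * k\<bar> \<le> 108 * M / (1 + x\<^sup>2)"
proof -
  have M: "M \<ge> 0"
    using assms abs_ge_zero[of k] by (smt (verit) mult_neg_pos)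
  have "\<bar>Q x * k\<bar> \<le> M * (Q x * (1 + \<bar>x\<bar>))"
    using mult_left_mono[OF assms, of "Q x"] Q_pos[of x] by (simp add: abs_mult mult_ac)
  also have "\<dots> \<le> M * (108 / (1 + x\<^sup>2))"
    by (intro mult_left_mono Q_weight_le M)
  finally show ?thesis by (simp add: mult.commute)
qed

lemma integrable_inverse_1_plus_sq: "integrable lborel (\<lambda>x. 1 / (1 + x\<^sup>2) :: real)"
  and integral_inverse_1_plus_sq: "(\<integral>x. 1 / (1 + x\<^sup>2) \<partial>lborel) = pi"
proof -
  have D: "DERIV arctan x :> 1 / (1 + x\<^sup>2)" for x
    by (auto intro!: derivative_eq_intros simp: field_simps)
  have ne: "1 + x\<^sup>2 \<noteq> 0" for x :: real
    by (metis add_pos_nonneg less_numeral_extra(3) zero_le_power2 zero_less_one)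
  have c: "isCont (\<lambda>x::real. 1 / (1 + x\<^sup>2)) x" for x
    by (intro continuous_intros ne)
  have nn: "0 \<le> 1 / (1 + x\<^sup>2)" for x :: real
    by simp
  have A: "((arctan \<circ> real_of_ereal) \<longlongrightarrow> - (pi / 2)) (at_right (- \<infinity>))"
    using tendsto_arctan_at_bot by (simp add: ereal_tendsto_simps)
  have B: "((arctan \<circ> real_of_ereal) \<longlongrightarrow> pi / 2) (at_left \<infinity>)"
    using tendsto_arctan_at_top by (simp add: ereal_tendsto_simps)
  have "set_integrable lborel (einterval (-\<infinity>) \<infinity>) (\<lambda>x::real. 1 / (1 + x\<^sup>2))"
    by (rule interval_integral_FTC_nonneg(1)[OF _ D c _ A B]) (auto simp: nn)
  then show i: "integrable lborel (\<lambda>x. 1 / (1 + x\<^sup>2) :: real)"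
    by (simp add: set_integrable_def)
  have "(LBINT x=-\<infinity>..\<infinity>. 1 / (1 + x\<^sup>2)) = pi / 2 - - (pi / 2)"
    by (rule interval_integral_FTC_nonneg(2)[OF _ D c _ A B]) (auto simp: nn)
  then show "(\<integral>x. 1 / (1 + x\<^sup>2) \<partial>lborel) = pi"
    by (simp add: interval_integral_to_infinity_eq interval_lebesgue_integral_def set_lebesgue_integral_def)
qed

lemma Q_integrable:
  assumes k: "continuous_on UNIV k" and b: "\<And>x. \<bar>k x\<bar> \<le> M * (1 + \<bar>x\<bar>)"
  shows "integrable lborel (\<lambda>x. Q x * k x)"
proof (rule Bochner_Integration.integrable_bound)
  show "integrable lborel (\<lambda>x. 108 * M * (1 / (1 + x\<^sup>2)))"
    by (intro integrable_mult_right integrable_inverse_1_plus_sq)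
  have "continuous_on UNIV (\<lambda>x. Q x * k x)"
    by (intro continuous_intros k)
  then show "(\<lambda>x. Q x * k x) \<in> borel_measurable lborel"
    using borel_measurable_continuous_onI by auto
  show "AE x in lborel. norm (Q x * k x) \<le> norm (108 * M * (1 / (1 + x\<^sup>2)))"
  proof (intro AE_I2)
    fix x
    have "norm (Q x * k x) \<le> 108 * M * (1 / (1 + x\<^sup>2))"
      using Q_mult_bound[OF b[of x]] by simp
    also have "\<dots> \<le> norm \<dots>" unfolding real_norm_def by (rule abs_ge_self)
    finally show "norm (Q x * k x) \<le> norm (108 * M * (1 / (1 + x\<^sup>2)))" .
  qed
qed

lemma Q_integral_bound:
  assumes k: "continuous_on UNIV k" and b: "\<And>x. \<bar>k x\<bar> \<le> M * (1 + \<bar>x\<bar>)"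
  shows "\<bar>\<integral>x. Q x * k x \<partial>lborel\<bar> \<le> 108 * M * pi"
proof -
  have "norm (\<integral>x. Q x * k x \<partial>lborel) \<le> (\<integral>x. 108 * M * (1 / (1 + x\<^sup>2)) \<partial>lborel)"
  proof (rule Bochner_Integration.integral_norm_bound_integral)
    show "integrable lborel (\<lambda>x. Q x * k x)"
      by (rule Q_integrable[OF assms])
    show "integrable lborel (\<lambda>x. 108 * M * (1 / (1 + x\<^sup>2)))"
      by (intro integrable_mult_right integrable_inverse_1_plus_sq)
    show "\<And>x. norm (Q x * k x) \<le> 108 * M * (1 / (1 + x\<^sup>2))"
      using Q_mult_bound[OF b] by simp
  qed
  also have "\<dots> = 108 * M * pi"
    by (subst integral_mult_right_zero) (simp add: integral_inverse_1_plus_sq)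
  finally show ?thesis by simp
qed

lemma Q_integral_deriv:
  assumes D: "\<And>x. DERIV g x :> Q x * k x"
    and k: "continuous_on UNIV k" and b: "\<And>x. \<bar>k x\<bar> \<le> M * (1 + \<bar>x\<bar>)"
    and top: "(g \<longlongrightarrow> r) at_top" and bot: "(g \<longlongrightarrow> l) at_bot"
  shows "(\<integral>x. Q x * k x \<partial>lborel) = r - l"
proof -
  have "continuous_on UNIV (\<lambda>x. Q x * k x)"
    by (intro continuous_intros k)
  then have c: "isCont (\<lambda>x. Q x * k x) x" for x
    by (simp add: continuous_on_eq_continuous_at)
  have "(LBINT x=-\<infinity>..\<infinity>. Q x * k x) = r - l"
  proof (rule interval_integral_FTC_integrable)
    show "\<And>x. (g has_vector_derivative Q x * k x) (at x)"
      using D by (simp add: has_real_derivative_iff_has_vector_derivative)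
    show "set_integrable lborel (einterval (-\<infinity>) \<infinity>) (\<lambda>x. Q x * k x)"
      using Q_integrable[OF k b] by (simp add: set_integrable_def)
    show "((g \<circ> real_of_ereal) \<longlongrightarrow> l) (at_right (- \<infinity>))" "((g \<circ> real_of_ereal) \<longlongrightarrow> r) (at_left \<infinity>)"
      using top bot by (simp_all add: ereal_tendsto_simps)
  qed (auto simp: c)
  then show ?thesis
    by (simp add: interval_lebesgue_integral_def set_lebesgue_integral_def)
qed

lemma increment_bound:
  assumes "x \<le> y"
    and "\<And>t. x \<le> t \<Longrightarrow> t \<le> y \<Longrightarrow> DERIV g t :> g' t"
    and "\<And>t. x \<le> t \<Longrightarrow> t \<le> y \<Longrightarrow> DERIV H t :> h t"
    and "\<And>t. x \<le> t \<Longrightarrow> t \<le> y \<Longrightarrow> \<bar>g' t\<bar> \<le> h t"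
  shows "\<bar>g y - g x\<bar> \<le> H y - (H x :: real)"
proof -
  have "(\<lambda>t. H t - g t) x \<le> (\<lambda>t. H t - g t) y"
    using assms(1)
    by (rule DERIV_nonneg_imp_nondecreasing)
       (use assms in \<open>force intro!: exI[of _ "h _ - g' _"] DERIV_diff\<close>)
  moreover have "(\<lambda>t. H t + g t) x \<le> (\<lambda>t. H t + g t) y"
    using assms(1)
    by (rule DERIV_nonneg_imp_nondecreasing)
       (use assms in \<open>force intro!: exI[of _ "h _ + g' _"] DERIV_add\<close>)
  ultimately show ?thesis by linarith
qed

text \<open>A substitute for \<open>g x = - \<integral> g'\<close> over the half line that uses a primitive \<open>H\<close> of a majorant of \<open>|g'|\<close> and so
needs no integral of \<open>g'\<close>.\<close>
lemma bound_from_top: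
  assumes "\<And>t. x \<le> t \<Longrightarrow> DERIV g t :> g' t"
    and "\<And>t. x \<le> t \<Longrightarrow> DERIV H t :> h t"
    and "\<And>t. x \<le> t \<Longrightarrow> \<bar>g' t\<bar> \<le> h t"
    and top: "(g \<longlongrightarrow> 0) at_top" and L: "\<And>t. x \<le> t \<Longrightarrow> H t \<le> L"
  shows "\<bar>g x\<bar> \<le> L - (H x :: real)"
proof -
  have "eventually (\<lambda>y. \<bar>g y - g x\<bar> \<le> L - H x) at_top"
    using eventually_ge_at_top[of x]
  proof eventually_elim
    case (elim y)
    then have "\<bar>g y - g x\<bar> \<le> H y - H x"
      using assms by (intro increment_bound) auto
    then show ?case using L[OF elim] by linarith
  qed
  moreover have "((\<lambda>y. \<bar>g y - g x\<bar>) \<longlongrightarrow> \<bar>0 - g x\<bar>) at_top"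
    by (intro tendsto_intros top)
  ultimately have "\<bar>0 - g x\<bar> \<le> L - H x"
    using tendsto_upperbound trivial_limit_at_top_linorder by blast
  then show ?thesis by simp
qed

lemma bound_from_bot:
  assumes D: "\<And>t. t \<le> x \<Longrightarrow> DERIV g t :> g' t"
    and DH: "\<And>t. t \<le> x \<Longrightarrow> DERIV H t :> h t"
    and b: "\<And>t. t \<le> x \<Longrightarrow> \<bar>g' t\<bar> \<le> h t"
    and bot: "(g \<longlongrightarrow> 0) at_bot" and L: "\<And>t. t \<le> x \<Longrightarrow> L \<le> H t"
  shows "\<bar>g x\<bar> \<le> H x - (L :: real)"
proof -
  have "\<bar>(\<lambda>t. g (- t)) (- x)\<bar> \<le> - L - (\<lambda>t. - H (- t)) (- x)"
  proof (rule bound_from_top[where g = "\<lambda>t. g (- t)" and H = "\<lambda>t. - H (- t)" and x = "- x"])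
    show "DERIV (\<lambda>t. g (- t)) t :> - g' (- t)" if "- x \<le> t" for t
      using D[of "-t"] that by (simp add: DERIV_mirror)
    show "DERIV (\<lambda>t. - H (- t)) t :> h (- t)" if "- x \<le> t" for t
      using DERIV_minus[OF iffD1[OF DERIV_mirror DH[of "-t"]]] that by simp
    show "((\<lambda>t. g (- t)) \<longlongrightarrow> 0) at_top"
      using bot by (simp add: filterlim_at_bot_mirror)
  qed (use b L in auto)
  then show ?thesis by simp
qed

text \<open>Barbalat's argument: if \<open>|g| \<ge> \<eta>\<close> at arbitrarily large points, the bound on \<open>g'\<close> keeps \<open>|g| \<ge> \<eta> / 2\<close> on
intervals of a fixed length, and each of them adds a fixed amount to the bounded primitive \<open>K\<close> of \<open>g\<^sup>2\<close>.\<close>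
lemma sq_integrable_Lipschitz_tendsto_0_top:
  fixes g :: "real \<Rightarrow> real"
  assumes K: "\<And>x. DERIV K x :> (g x)\<^sup>2" and S: "\<And>x. K x \<le> S"
    and D: "\<And>x. DERIV g x :> g' x" and B: "\<And>x. \<bar>g' x\<bar> \<le> B"
  shows "(g \<longlongrightarrow> 0) at_top"
proof (rule ccontr)
  assume "\<not> ?thesis"
  then obtain \<eta> where \<eta>: "\<eta> > 0" and "\<not> eventually (\<lambda>x. \<bar>g x\<bar> < \<eta>) at_top"
    by (auto simp: tendsto_iff dist_real_def)
  then have far: "\<exists>y\<ge>X. \<eta> \<le> \<bar>g y\<bar>" for X
    by (auto simp: eventually_at_top_linorder not_less)
  have B0: "B \<ge> 0" using B[of 0] by linarith
  define d where "d = \<eta> / (2 * (B + 1))"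
  have d: "d > 0" "B * d \<le> \<eta> / 2"
    using \<eta> B0 by (auto simp: d_def field_simps)
  have mono: "K x \<le> K y" if "x \<le> y" for x y
    using DERIV_nonneg_imp_nondecreasing[OF that] K zero_le_power2 by blast
  have bdd: "bdd_above (range K)"
    using S by (auto intro!: bdd_aboveI)
  define s where "s = (SUP x. K x)"
  define e where "e = (\<eta> / 2)\<^sup>2 * d"
  have "e > 0" using \<eta> d by (simp add: e_def)
  then obtain X where X: "s - e < K X"
    using less_cSUP_iff[OF _ bdd, of "s - e"] by (auto simp: s_def)
  obtain y where y: "y \<ge> X" "\<eta> \<le> \<bar>g y\<bar>" using far by blast
  have low: "\<eta> / 2 \<le> \<bar>g t\<bar>" if "y \<le> t" "t \<le> y + d" for t
  proof -
    have "\<bar>g t - g y\<bar> \<le> B * t - B * y"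
      by (rule increment_bound[OF that(1) D, where h = "\<lambda>_. B"])
         (auto intro!: derivative_eq_intros B)
    also have "\<dots> \<le> \<eta> / 2"
      using mult_left_mono[of "t - y" d B] that d B0 by (simp add: algebra_simps)
    finally show ?thesis using y(2) by linarith
  qed
  have "(\<lambda>t. K t - (\<eta> / 2)\<^sup>2 * t) y \<le> (\<lambda>t. K t - (\<eta> / 2)\<^sup>2 * t) (y + d)"
  proof (rule DERIV_nonneg_imp_nondecreasing[where f = "\<lambda>t. K t - (\<eta> / 2)\<^sup>2 * t"])
    fix t assume t: "y \<le> t" "t \<le> y + d"
    have "(\<eta> / 2)\<^sup>2 \<le> \<bar>g t\<bar>\<^sup>2"
      using low[OF t] \<eta> by (intro power_mono) auto
    moreover have "DERIV (\<lambda>t. K t - (\<eta> / 2)\<^sup>2 * t) t :> (g t)\<^sup>2 - (\<eta> / 2)\<^sup>2"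
      by (auto intro!: derivative_eq_intros K)
    ultimately show "\<exists>z. DERIV (\<lambda>t. K t - (\<eta> / 2)\<^sup>2 * t) t :> z \<and> 0 \<le> z"
      by auto
  qed (use d in auto)
  then have "K y + e \<le> K (y + d)"
    by (simp add: e_def algebra_simps)
  moreover have "K (y + d) \<le> s"
    unfolding s_def by (intro cSUP_upper bdd) auto
  ultimately show False
    using X mono[OF y(1)] by linarith
qed

lemma sq_integrable_Lipschitz_tendsto_0:
  fixes g :: "real \<Rightarrow> real"
  assumes K: "\<And>x. DERIV K x :> (g x)\<^sup>2" and S: "\<And>x. \<bar>K x\<bar> \<le> S"
    and D: "\<And>x. DERIV g x :> g' x" and B: "\<And>x. \<bar>g' x\<bar> \<le> B"
  shows "(g \<longlongrightarrow> 0) at_top" "(g \<longlongrightarrow> 0) at_bot"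
proof -
  have S': "K x \<le> S" "- K x \<le> S" for x
    using S[of x] by auto
  show "(g \<longlongrightarrow> 0) at_top"
    by (rule sq_integrable_Lipschitz_tendsto_0_top[OF K S'(1) D B])
  have "((\<lambda>x. g (- x)) \<longlongrightarrow> 0) at_top"
  proof (rule sq_integrable_Lipschitz_tendsto_0_top)
    show "DERIV (\<lambda>x. - K (- x)) x :> (g (- x))\<^sup>2" for x
      using DERIV_minus[OF iffD1[OF DERIV_mirror K[of "-x"]]] by simp
    show "DERIV (\<lambda>x. g (- x)) x :> - g' (- x)" for x
      using D[of "-x"] by (simp add: DERIV_mirror)
  qed (use S' B in auto)
  then show "(g \<longlongrightarrow> 0) at_bot"
    by (simp add: filterlim_at_bot_mirror)
qed

section \<open>Explicit solutions of the linearized system at the threshold\<close>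

text \<open>The equations are \<open>L\<^sub>+ \<phi> = \<psi>\<close> and \<open>L\<^sub>- \<psi> = \<phi>\<close>, solved for the second derivatives.\<close>
locale homogeneous_pair =
  fixes \<phi> \<phi>' \<psi> \<psi>' :: "real \<Rightarrow> real"
  assumes D\<phi>: "DERIV \<phi> x :> \<phi>' x"
    and D\<phi>': "DERIV \<phi>' x :> \<phi> x - 3 * (Q x)\<^sup>2 * \<phi> x - \<psi> x"
    and D\<psi>: "DERIV \<psi> x :> \<psi>' x"
    and D\<psi>': "DERIV \<psi>' x :> \<psi> x - (Q x)\<^sup>2 * \<psi> x - \<phi> x"

text \<open>The threshold resonance \<open>(1 - Q\<^sup>2, 1)\<close>; hyperbolic tangents make the differential equations polynomial
identities.\<close>
definition res_U :: "real \<Rightarrow> real" where "res_U x = 2 * (tanh x)\<^sup>2 - 1"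
definition res_U' :: "real \<Rightarrow> real" where "res_U' x = 4 * tanh x * (1 - (tanh x)\<^sup>2)"

lemma abs_res_U_le: "\<bar>res_U x\<bar> \<le> 1"
  using tanh_sq_le[of x] zero_le_power2[of "tanh x"] by (simp add: res_U_def abs_le_iff)

interpretation res: homogeneous_pair res_U res_U' "\<lambda>x. 1" "\<lambda>x. 0"
  by unfold_locales
    (auto intro!: derivative_eq_intros simp: res_U_def[abs_def] res_U'_def[abs_def] Q_sq, algebra+)

text \<open>The four homogeneous solutions come from the integrable structure: with \<open>S = \<partial> + tanh\<close>, which annihilates
\<open>Q\<close>, one has \<open>S\<^sup>2 L\<^sub>+ L\<^sub>- = (1 - \<partial>\<^sup>2)\<^sup>2 S\<^sup>2\<close>. Hence \<open>Z = S\<^sup>2 \<psi>\<close> solves \<open>Z'''' = 2 Z''\<close>, so that \<open>Z\<close> is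
a combination of \<open>1\<close>, \<open>x\<close> and \<open>exp (\<plusminus> \<surd>2 x)\<close>. The choice \<open>Z = 1\<close> gives the resonance, \<open>Z = x\<close> the present
linearly growing pair, and the exponentials the pairs below.\<close>
definition lin_U :: "real \<Rightarrow> real" where "lin_U x = x * (2 * (tanh x)\<^sup>2 - 1) - 2 * tanh x"
definition lin_U' :: "real \<Rightarrow> real" where
  "lin_U' x = 2 * (tanh x)\<^sup>2 - 1 + 4 * x * tanh x * (1 - (tanh x)\<^sup>2) - 2 * (1 - (tanh x)\<^sup>2)"
definition lin_W :: "real \<Rightarrow> real" where "lin_W x = x - 2 * tanh x"
definition lin_W' :: "real \<Rightarrow> real" where "lin_W' x = 1 - 2 * (1 - (tanh x)\<^sup>2)"

interpretation lin: homogeneous_pair lin_U lin_U' lin_W lin_W'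
  by unfold_locales
    (auto intro!: derivative_eq_intros
      simp: lin_U_def[abs_def] lin_U'_def[abs_def] lin_W_def[abs_def] lin_W'_def[abs_def] Q_sq, algebra+)

definition exp_U :: "real \<Rightarrow> real \<Rightarrow> real" where
  "exp_U \<mu> x = - exp (\<mu> * x) * (1 - 2 * \<mu> * tanh x + 2 * (tanh x)\<^sup>2)"
definition exp_U' :: "real \<Rightarrow> real \<Rightarrow> real" where
  "exp_U' \<mu> x = - exp (\<mu> * x) * (4 * \<mu> * (tanh x)\<^sup>2 - 4 * (tanh x) ^ 3 - \<mu>)"
definition exp_W :: "real \<Rightarrow> real \<Rightarrow> real" where
  "exp_W \<mu> x = exp (\<mu> * x) * (3 - 2 * \<mu> * tanh x)"
definition exp_W' :: "real \<Rightarrow> real \<Rightarrow> real" where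
  "exp_W' \<mu> x = exp (\<mu> * x) * (\<mu> - 4 * tanh x + 2 * \<mu> * (tanh x)\<^sup>2)"

lemma exp_homogeneous_pair:
  assumes "\<mu>\<^sup>2 = 2"
  shows "homogeneous_pair (exp_U \<mu>) (exp_U' \<mu>) (exp_W \<mu>) (exp_W' \<mu>)"
proof
  fix x
  have m: "\<mu> * \<mu> = 2" "\<mu> * (\<mu> * z) = 2 * z" for z
    using assms by (simp_all add: power2_eq_square flip: mult.assoc)
  note d = exp_U_def[abs_def] exp_U'_def[abs_def] exp_W_def[abs_def] exp_W'_def[abs_def] Q_sq
  show "DERIV (exp_U \<mu>) x :> exp_U' \<mu> x"
    unfolding d by (rule derivative_eq_intros refl | simp)+ (simp add: m algebra_simps power2_eq_square power3_eq_cube)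
  show "DERIV (exp_U' \<mu>) x :> exp_U \<mu> x - 3 * (Q x)\<^sup>2 * exp_U \<mu> x - exp_W \<mu> x"
    unfolding d by (rule derivative_eq_intros refl | simp)+ (simp add: m algebra_simps power2_eq_square power3_eq_cube)
  show "DERIV (exp_W \<mu>) x :> exp_W' \<mu> x"
    unfolding d by (rule derivative_eq_intros refl | simp)+ (simp add: m algebra_simps power2_eq_square power3_eq_cube)
  show "DERIV (exp_W' \<mu>) x :> exp_W \<mu> x - (Q x)\<^sup>2 * exp_W \<mu> x - exp_U \<mu> x"
    unfolding d by (rule derivative_eq_intros refl | simp)+ (simp add: m algebra_simps power2_eq_square power3_eq_cube)
qed


text \<open>Limits of Wronskians are limits of products in which one factor is only known to be bounded.\<close>
lemma tendsto_mult_bounded_0: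
  fixes f g :: "real \<Rightarrow> real"
  assumes "(f \<longlongrightarrow> 0) F" and "\<And>x. \<bar>g x\<bar> \<le> B"
  shows "((\<lambda>x. f x * g x) \<longlongrightarrow> 0) F" "((\<lambda>x. g x * f x) \<longlongrightarrow> 0) F"
proof -
  have "((\<lambda>x. \<bar>f x\<bar> * B) \<longlongrightarrow> \<bar>0\<bar> * B) F"
    by (intro tendsto_intros assms)
  then have lim: "((\<lambda>x. \<bar>f x\<bar> * B) \<longlongrightarrow> 0) F" by simp
  have "norm (f x * g x) \<le> \<bar>f x\<bar> * B" for x
    using assms(2)[of x] by (simp add: abs_mult mult_left_mono)
  then show "((\<lambda>x. f x * g x) \<longlongrightarrow> 0) F"
    by (intro Lim_null_comparison[OF _ lim] always_eventually allI)
  then show "((\<lambda>x. g x * f x) \<longlongrightarrow> 0) F"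
    by (simp add: mult.commute)
qed

lemma tanh_sq_tendsto_1: "((\<lambda>x::real. (tanh x)\<^sup>2) \<longlongrightarrow> 1) at_top" "((\<lambda>x::real. (tanh x)\<^sup>2) \<longlongrightarrow> 1) at_bot"
  using tendsto_power[OF tanh_real_at_top, of 2] tendsto_power[OF tanh_real_at_bot, of 2] by simp_all

lemma sech_sq_tendsto_0:
  "((\<lambda>x::real. 1 - (tanh x)\<^sup>2) \<longlongrightarrow> 0) at_top" "((\<lambda>x::real. 1 - (tanh x)\<^sup>2) \<longlongrightarrow> 0) at_bot"
  using tendsto_diff[OF tendsto_const[of 1] tanh_sq_tendsto_1(1)]
    tendsto_diff[OF tendsto_const[of 1] tanh_sq_tendsto_1(2)] by simp_all

lemma exp_pair_bounds:
  assumes \<mu>: "\<mu>\<^sup>2 = 2"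
  shows "\<bar>exp_U \<mu> x\<bar> \<le> 12 * exp (\<mu> * x)" "\<bar>exp_U' \<mu> x\<bar> \<le> 12 * exp (\<mu> * x)"
    "\<bar>exp_W \<mu> x\<bar> \<le> 12 * exp (\<mu> * x)" "\<bar>exp_W' \<mu> x\<bar> \<le> 12 * exp (\<mu> * x)"
proof -
  have m: "\<bar>\<mu>\<bar> \<le> 3/2"
    by (rule power2_le_imp_le) (simp_all add: \<mu> power_divide)
  have T: "\<bar>tanh x\<bar> \<le> 1" "\<bar>(tanh x)\<^sup>2\<bar> \<le> 1" "\<bar>(tanh x)^3\<bar> \<le> 1"
    using abs_tanh_le[of x] tanh_sq_le[of x] power_le_one[of "\<bar>tanh x\<bar>" 3]
    by (simp_all add: power_abs)
  have mT: "\<bar>\<mu> * tanh x\<bar> \<le> 3/2" "\<bar>\<mu> * (tanh x)\<^sup>2\<bar> \<le> 3/2"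
    using mult_mono[OF m T(1)] mult_mono[OF m T(2)] by (simp_all add: abs_mult)
  have E: "\<bar>exp (\<mu> * x) * c\<bar> \<le> 12 * exp (\<mu> * x)" if "\<bar>c\<bar> \<le> 12" for c
    using that by (simp add: abs_mult)
  show "\<bar>exp_U \<mu> x\<bar> \<le> 12 * exp (\<mu> * x)"
    unfolding exp_U_def mult_minus_left abs_minus_cancel mult.assoc
    by (rule E) (use T mT in linarith)
  show "\<bar>exp_U' \<mu> x\<bar> \<le> 12 * exp (\<mu> * x)"
    unfolding exp_U'_def mult_minus_left abs_minus_cancel mult.assoc
    by (rule E) (use m T(3) mT(2) in linarith)
  show "\<bar>exp_W \<mu> x\<bar> \<le> 12 * exp (\<mu> * x)"
    unfolding exp_W_def mult.assoc
    by (rule E) (use T mT in linarith)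
  show "\<bar>exp_W' \<mu> x\<bar> \<le> 12 * exp (\<mu> * x)"
    unfolding exp_W'_def mult.assoc
    by (rule E) (use m T mT in linarith)
qed

text \<open>Bounded solutions of \<open>L\<^sub>- W = U\<close>, \<open>L\<^sub>+ U = W + Q N\<close> with a given forcing \<open>N\<close>. The decay of the derivatives is
what removes the boundary terms; it comes from their square integrability.\<close>
locale forced_solution =
  fixes U U' W W' N :: "real \<Rightarrow> real" and B :: real
  assumes DU: "DERIV U x :> U' x"
    and DU': "DERIV U' x :> U x - 3 * (Q x)\<^sup>2 * U x - W x - Q x * N x"
    and DW: "DERIV W x :> W' x"
    and DW': "DERIV W' x :> W x - (Q x)\<^sup>2 * W x - U x"
    and bdd: "\<bar>U x\<bar> \<le> B" "\<bar>W x\<bar> \<le> B"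
    and U'_lim: "(U' \<longlongrightarrow> 0) at_top" "(U' \<longlongrightarrow> 0) at_bot"
    and W'_lim: "(W' \<longlongrightarrow> 0) at_top" "(W' \<longlongrightarrow> 0) at_bot"
    and N_cont: "continuous_on UNIV N"
begin

lemma U_cont: "continuous_on A U"
  using DU by (meson DERIV_continuous_on has_field_derivative_at_within)

definition wronskian ::
  "(real \<Rightarrow> real) \<Rightarrow> (real \<Rightarrow> real) \<Rightarrow> (real \<Rightarrow> real) \<Rightarrow> (real \<Rightarrow> real) \<Rightarrow> real \<Rightarrow> real" where
  "wronskian \<phi> \<phi>' \<psi> \<psi>' x = U' x * \<phi> x - U x * \<phi>' x + W' x * \<psi> x - W x * \<psi>' x"

text \<open>Green's identity for the self-adjoint operators \<open>L\<^sub>+\<close> and \<open>L\<^sub>-\<close>: everything cancels except the forcing.\<close>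
lemma wronskian_DERIV:
  assumes "homogeneous_pair \<phi> \<phi>' \<psi> \<psi>'"
  shows "DERIV (wronskian \<phi> \<phi>' \<psi> \<psi>') x :> Q x * (- N x * \<phi> x)"
proof -
  interpret homogeneous_pair \<phi> \<phi>' \<psi> \<psi>' by fact
  show ?thesis
    unfolding wronskian_def[abs_def]
    by (rule derivative_eq_intros DU DU' DW DW' D\<phi> D\<phi>' D\<psi> D\<psi>' refl)+ (simp add: algebra_simps)
qed

lemma wronskian_tendsto_0:
  assumes "(U' \<longlongrightarrow> 0) F" "(W' \<longlongrightarrow> 0) F" "(\<phi> \<longlongrightarrow> 0) F" "(\<phi>' \<longlongrightarrow> 0) F" "(\<psi> \<longlongrightarrow> 0) F" "(\<psi>' \<longlongrightarrow> 0) F"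
  shows "(wronskian \<phi> \<phi>' \<psi> \<psi>' \<longlongrightarrow> 0) F"
proof -
  have "((\<lambda>x. U' x * \<phi> x - U x * \<phi>' x + W' x * \<psi> x - W x * \<psi>' x) \<longlongrightarrow> 0 - 0 + 0 - 0) F"
    by (intro tendsto_add tendsto_diff tendsto_mult_zero tendsto_mult_bounded_0(2)[where B = B] assms bdd)
  then show ?thesis by (simp add: wronskian_def[abs_def])
qed

lemma res_wronskian_lim:
  "(wronskian res_U res_U' (\<lambda>x. 1) (\<lambda>x. 0) \<longlongrightarrow> 0) at_top"
  "(wronskian res_U res_U' (\<lambda>x. 1) (\<lambda>x. 0) \<longlongrightarrow> 0) at_bot"
proof -
  have "(wronskian res_U res_U' (\<lambda>x. 1) (\<lambda>x. 0) \<longlongrightarrow> 0) F"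
    if "(U' \<longlongrightarrow> 0) F" "(W' \<longlongrightarrow> 0) F" "((\<lambda>x::real. 1 - (tanh x)\<^sup>2) \<longlongrightarrow> 0) F" for F
  proof -
    have t: "\<bar>4 * tanh x\<bar> \<le> 4" for x :: real
      using abs_tanh_le[of x] by simp
    have "(res_U' \<longlongrightarrow> 0) F"
      unfolding res_U'_def[abs_def] by (rule tendsto_mult_bounded_0(2)[OF that(3) t])
    then have "((\<lambda>x. U' x * res_U x - U x * res_U' x + W' x * 1 - W x * 0) \<longlongrightarrow> 0 - 0 + 0 * 1 - 0) F"
      by (intro tendsto_add tendsto_diff tendsto_mult[OF that(2) tendsto_const]
          tendsto_mult_bounded_0[where B = 1] tendsto_mult_bounded_0(2)[where B = B]
          that abs_res_U_le bdd) auto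
    then show ?thesis by (simp add: wronskian_def[abs_def])
  qed
  then show "(wronskian res_U res_U' (\<lambda>x. 1) (\<lambda>x. 0) \<longlongrightarrow> 0) at_top"
    "(wronskian res_U res_U' (\<lambda>x. 1) (\<lambda>x. 0) \<longlongrightarrow> 0) at_bot"
    using U'_lim W'_lim sech_sq_tendsto_0 by blast+
qed

text \<open>The four homogeneous solutions form a symplectic basis up to scaling: the only nonzero Wronskians among them
are that of the linearly growing pair with the resonance, equal to 2, and that of the two exponential
pairs, equal to \<open>4 s\<close>. Expanding \<open>(U, U', W, W')\<close> in this basis gives the identity.\<close>
lemma representation:
  fixes s :: real
  assumes s: "s\<^sup>2 = 2"
  shows "8 * U x = 4 * wronskian res_U res_U' (\<lambda>x. 1) (\<lambda>x. 0) x * lin_U x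
    - 4 * wronskian lin_U lin_U' lin_W lin_W' x * res_U x
    + s * (wronskian (exp_U (-s)) (exp_U' (-s)) (exp_W (-s)) (exp_W' (-s)) x * exp_U s x
      - wronskian (exp_U s) (exp_U' s) (exp_W s) (exp_W' s) x * exp_U (-s) x)"
proof -
  define a where "a \<mu> = - (1 - 2 * \<mu> * tanh x + 2 * (tanh x)\<^sup>2)" for \<mu>
  define w where "w \<mu> = U' x * a \<mu> + U x * (4 * \<mu> * (tanh x)\<^sup>2 - 4 * (tanh x) ^ 3 - \<mu>)
    + W' x * (3 - 2 * \<mu> * tanh x) - W x * (\<mu> - 4 * tanh x + 2 * \<mu> * (tanh x)\<^sup>2)" for \<mu>
  have A: "exp_U \<mu> x = exp (\<mu> * x) * a \<mu>" for \<mu>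
    by (simp add: exp_U_def a_def algebra_simps)
  have Wr: "wronskian (exp_U \<mu>) (exp_U' \<mu>) (exp_W \<mu>) (exp_W' \<mu>) x = exp (\<mu> * x) * w \<mu>" for \<mu>
    by (simp add: wronskian_def exp_U'_def exp_W_def exp_W'_def w_def A algebra_simps)
  have e: "exp (s * x) * exp (- s * x) = 1"
    by (simp flip: exp_add)
  have P: "wronskian (exp_U (-s)) (exp_U' (-s)) (exp_W (-s)) (exp_W' (-s)) x * exp_U s x = w (-s) * a s"
    "wronskian (exp_U s) (exp_U' s) (exp_W s) (exp_W' s) x * exp_U (-s) x = w s * a (-s)"
    unfolding A Wr using e by (simp_all add: mult_ac)
  have m: "s * s = 2" "s * (s * z) = 2 * z" for z
    using s by (simp_all add: power2_eq_square flip: mult.assoc)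
  show ?thesis
    unfolding P
    by (simp add: w_def a_def wronskian_def res_U_def res_U'_def lin_U_def lin_U'_def lin_W_def lin_W'_def
        m algebra_simps power2_eq_square power3_eq_cube)
qed

end

section \<open>A priori estimate and orthogonality relations\<close>

lemma pi_bounds: "0 < pi" "pi < 4"
  using pi_gt_zero pi_less_4 by auto

lemma Q_tendsto_0: "(Q \<longlongrightarrow> 0) at_top" "(Q \<longlongrightarrow> 0) at_bot"
proof -
  have *: "(Q \<longlongrightarrow> 0) F" if "((\<lambda>x::real. 1 - (tanh x)\<^sup>2) \<longlongrightarrow> 0) F" for F
  proof -
    have "((\<lambda>x. sqrt (2 * (1 - (tanh x)\<^sup>2))) \<longlongrightarrow> sqrt (2 * 0)) F"
      by (intro tendsto_intros that)
    moreover have "sqrt (2 * (1 - (tanh x)\<^sup>2)) = Q x" for x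
      unfolding Q_sq[symmetric] using Q_pos[of x] by simp
    ultimately show ?thesis by simp
  qed
  show "(Q \<longlongrightarrow> 0) at_top" "(Q \<longlongrightarrow> 0) at_bot"
    using * sech_sq_tendsto_0 by blast+
qed

lemma arctan_increment:
  fixes g :: "real \<Rightarrow> real"
  assumes D: "\<And>t. DERIV g t :> g' t" and b: "\<And>t. \<bar>g' t\<bar> \<le> C / (1 + t\<^sup>2)"
  shows "\<bar>g y - g x\<bar> \<le> C * 4"
proof -
  have C: "C \<ge> 0" using b[of 0] by simp
  have le: "\<bar>g y - g x\<bar> \<le> C * 4" if "x \<le> y" for x y
  proof -
    have "DERIV (\<lambda>t. C * arctan t) t :> C / (1 + t\<^sup>2)" for t
      by (auto intro!: derivative_eq_intros simp: divide_inverse)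
    then have "\<bar>g y - g x\<bar> \<le> C * arctan y - C * arctan x"
      by (intro increment_bound[OF that D _ b])
    also have "\<dots> = C * (arctan y - arctan x)" by (simp add: algebra_simps)
    also have "\<dots> \<le> C * 4"
      using arctan_bounded[of y] arctan_bounded[of x] pi_bounds C by (intro mult_left_mono) auto
    finally show ?thesis .
  qed
  show ?thesis
    using le[of x y] le[of y x] by (cases "x \<le> y") (auto simp: abs_minus_commute)
qed

lemma arctan_bound:
  fixes g :: "real \<Rightarrow> real"
  assumes D: "\<And>t. DERIV g t :> g' t" and b: "\<And>t. \<bar>g' t\<bar> \<le> C / (1 + t\<^sup>2)"
    and top: "(g \<longlongrightarrow> 0) at_top"
  shows "\<bar>g x\<bar> \<le> C * 4"
proof -
  have "((\<lambda>y. \<bar>g x - g y\<bar>) \<longlongrightarrow> \<bar>g x - 0\<bar>) at_top"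
    by (intro tendsto_intros top)
  then have "\<bar>g x - 0\<bar> \<le> C * 4"
    by (rule tendsto_upperbound) (auto intro!: always_eventually arctan_increment[OF D b])
  then show ?thesis by simp
qed

lemma res_U_continuous [continuous_intros]: "continuous_on A res_U"
  unfolding res_U_def[abs_def] by (intro continuous_intros) auto

lemma lin_U_bound: "\<bar>lin_U x\<bar> \<le> 2 * (1 + \<bar>x\<bar>)"
proof -
  have "\<bar>x * res_U x\<bar> \<le> \<bar>x\<bar>"
    using mult_left_mono[OF abs_res_U_le[of x], of "\<bar>x\<bar>"] by (simp add: abs_mult)
  moreover have "lin_U x = x * res_U x - 2 * tanh x"
    by (simp add: lin_U_def res_U_def)
  moreover have "\<bar>p - 2 * t\<bar> \<le> 2 * (1 + y)" if "\<bar>p\<bar> \<le> y" "\<bar>t\<bar> \<le> 1" for p t y :: real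
    using that by (auto simp: abs_if split: if_splits)
  ultimately show ?thesis
    using abs_tanh_le[of x] by metis
qed

text \<open>That this integral does not vanish is what allows \<open>\<integral> Q\<^sup>2 U\<close> to detect the resonant part of \<open>U\<close>.\<close>
lemma resonance_integral: "(\<integral>x. Q x * (Q x * res_U x) \<partial>lborel) = - 4 / 3"
proof -
  have "(\<integral>x. Q x * (Q x * res_U x) \<partial>lborel) = (4 / 3 * 1 ^ 3 - 2 * 1) - (4 / 3 * (-1) ^ 3 - 2 * (-1))"
  proof (rule Q_integral_deriv)
    show "DERIV (\<lambda>x. 4 / 3 * tanh x ^ 3 - 2 * tanh x) x :> Q x * (Q x * res_U x)" for x
    proof -
      have "Q x * (Q x * res_U x) = (Q x)\<^sup>2 * res_U x"
        by (simp add: power2_eq_square)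
      then have eq: "Q x * (Q x * res_U x) = 2 * (1 - (tanh x)\<^sup>2) * (2 * (tanh x)\<^sup>2 - 1)"
        by (simp only: Q_sq res_U_def)
      show ?thesis
        unfolding eq by (auto intro!: derivative_eq_intros simp: field_simps power2_eq_square)
    qed
    show "continuous_on UNIV (\<lambda>x. Q x * res_U x)"
      by (intro continuous_intros)
    show "\<bar>Q x * res_U x\<bar> \<le> 2 * (1 + \<bar>x\<bar>)" for x
    proof -
      have "\<bar>Q x\<bar> * \<bar>res_U x\<bar> \<le> 2 * 1"
        using Q_le_2[of x] Q_pos[of x] abs_res_U_le[of x] by (intro mult_mono) auto
      then show ?thesis by (simp add: abs_mult)
    qed
  qed (intro tendsto_intros tanh_real_at_top tanh_real_at_bot)+
  then show ?thesis by simp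
qed

context forced_solution
begin

lemma B_nonneg: "0 \<le> B"
  using bdd(1)[of 0] by linarith

text \<open>For either sign of \<open>\<mu>\<close> the homogeneous pair decays towards one end of the line, where the Wronskian vanishes;
integrating its derivative from that end gives the same exponential rate.\<close>
lemma exp_wronskian_bound:
  assumes \<mu>: "\<mu>\<^sup>2 = 2" and N: "\<And>x. \<bar>N x\<bar> \<le> \<delta>"
  shows "\<bar>\<mu> * wronskian (exp_U \<mu>) (exp_U' \<mu>) (exp_W \<mu>) (exp_W' \<mu>) x\<bar> \<le> 24 * \<delta> * exp (\<mu> * x)"
proof -
  let ?w = "wronskian (exp_U \<mu>) (exp_U' \<mu>) (exp_W \<mu>) (exp_W' \<mu>)"
  have D: "DERIV ?w t :> Q t * (- N t * exp_U \<mu> t)" for t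
    by (rule wronskian_DERIV[OF exp_homogeneous_pair[OF \<mu>]])
  have \<delta>: "\<delta> \<ge> 0" using N[of 0] by linarith
  have b: "\<bar>Q t * (- N t * exp_U \<mu> t)\<bar> \<le> 24 * \<delta> * exp (\<mu> * t)" for t
  proof -
    have "\<bar>N t\<bar> * \<bar>exp_U \<mu> t\<bar> \<le> \<delta> * (12 * exp (\<mu> * t))"
      using \<delta> by (intro mult_mono N exp_pair_bounds \<mu>) auto
    then have "\<bar>Q t\<bar> * (\<bar>N t\<bar> * \<bar>exp_U \<mu> t\<bar>) \<le> 2 * (\<delta> * (12 * exp (\<mu> * t)))"
      by (rule mult_mono[rotated]) (use Q_le_2[of t] Q_pos[of t] in auto)
    then show ?thesis by (simp add: abs_mult)
  qed
  have H: "DERIV (\<lambda>t. 24 * \<delta> / \<mu> * exp (\<mu> * t)) t :> 24 * \<delta> * exp (\<mu> * t)" for t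
    using \<mu> by (auto intro!: derivative_eq_intros)
  have lim: "(?w \<longlongrightarrow> 0) F"
    if e: "((\<lambda>x. exp (\<mu> * x)) \<longlongrightarrow> 0) F" and U: "(U' \<longlongrightarrow> 0) F" "(W' \<longlongrightarrow> 0) F" for F
  proof -
    from e have e12: "((\<lambda>x. 12 * exp (\<mu> * x)) \<longlongrightarrow> 0) F"
      using tendsto_mult[OF tendsto_const[of 12] e] by simp
    show ?thesis
      by (intro wronskian_tendsto_0 U)
         (rule Lim_null_comparison[OF _ e12], use exp_pair_bounds[OF \<mu>] in \<open>auto intro!: always_eventually\<close>)+
  qed
  consider "\<mu> < 0" | "\<mu> > 0" using \<mu> by (cases \<mu> "0::real" rule: linorder_cases) auto
  then show ?thesis
  proof cases
    case 1
    have "filterlim (\<lambda>x. \<mu> * x) at_bot at_top"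
      using 1 by (intro filterlim_tendsto_neg_mult_at_bot[OF tendsto_const]) (auto simp: filterlim_ident)
    from filterlim_compose[OF exp_at_bot this] have "(?w \<longlongrightarrow> 0) at_top"
      using U'_lim W'_lim by (intro lim) auto
    then have "\<bar>?w x\<bar> \<le> 0 - 24 * \<delta> / \<mu> * exp (\<mu> * x)"
      by (rule bound_from_top[OF D H b])
         (use 1 \<delta> in \<open>auto simp: divide_le_0_iff mult_le_0_iff\<close>)
    then show ?thesis using 1 by (simp add: abs_mult field_simps)
  next
    case 2
    have "filterlim (\<lambda>x. \<mu> * x) at_bot at_bot"
      using 2 by (intro filterlim_tendsto_pos_mult_at_bot[OF tendsto_const]) (auto simp: filterlim_ident)
    from filterlim_compose[OF exp_at_bot this] have "(?w \<longlongrightarrow> 0) at_bot"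
      using U'_lim W'_lim by (intro lim) auto
    then have "\<bar>?w x\<bar> \<le> 24 * \<delta> / \<mu> * exp (\<mu> * x) - 0"
      by (rule bound_from_bot[OF D H b])
         (use 2 \<delta> in \<open>auto simp: zero_le_divide_iff zero_le_mult_iff\<close>)
    then show ?thesis using 2 by (simp add: abs_mult field_simps)
  qed
qed

text \<open>In the representation of \<open>U\<close> the Wronskian with the linearly growing pair is a constant up to \<open>O(\<delta>)\<close>, and this
constant produces the multiple of the resonance. The Wronskian with the resonance is \<open>O(\<delta>)\<close> and gets multiplied
by a linearly growing function, which is the reason for the weight \<open>1 + |x|\<close>; in the remaining two terms the
exponentials cancel.\<close>
lemma near_resonance:
  assumes N: "\<And>x. \<bar>N x\<bar> \<le> \<delta>"
  obtains a where "\<And>x. \<bar>U x - a * res_U x\<bar> \<le> 1000 * \<delta> * (1 + \<bar>x\<bar>)"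
proof
  let ?R = "wronskian res_U res_U' (\<lambda>x. 1) (\<lambda>x. 0)"
  let ?L = "wronskian lin_U lin_U' lin_W lin_W'"
  let ?E = "\<lambda>\<mu>. wronskian (exp_U \<mu>) (exp_U' \<mu>) (exp_W \<mu>) (exp_W' \<mu>)"
  define a where "a = - ?L 0 / 2"
  fix x
  have \<delta>: "\<delta> \<ge> 0" using N[of 0] by linarith
  have R: "\<bar>?R x\<bar> \<le> 108 * \<delta> * 4"
  proof (rule arctan_bound[OF wronskian_DERIV[OF res.homogeneous_pair_axioms] Q_mult_bound res_wronskian_lim(1)])
    fix t
    have "\<bar>N t\<bar> * \<bar>res_U t\<bar> \<le> \<delta> * 1"
      using \<delta> by (intro mult_mono N abs_res_U_le) auto
    also have "\<dots> \<le> \<delta> * (1 + \<bar>t\<bar>)" using \<delta> by (intro mult_left_mono) auto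
    finally show "\<bar>- N t * res_U t\<bar> \<le> \<delta> * (1 + \<bar>t\<bar>)" by (simp add: abs_mult)
  qed
  have L: "\<bar>?L x - ?L 0\<bar> \<le> 108 * (2 * \<delta>) * 4"
  proof (rule arctan_increment[OF wronskian_DERIV[OF lin.homogeneous_pair_axioms] Q_mult_bound])
    fix t
    have "\<bar>N t\<bar> * \<bar>lin_U t\<bar> \<le> \<delta> * (2 * (1 + \<bar>t\<bar>))"
      using \<delta> by (intro mult_mono N lin_U_bound) auto
    then show "\<bar>- N t * lin_U t\<bar> \<le> 2 * \<delta> * (1 + \<bar>t\<bar>)" by (simp add: abs_mult algebra_simps)
  qed
  have E: "\<bar>\<mu> * ?E \<mu> x * exp_U (-\<mu>) x\<bar> \<le> 288 * \<delta>" if "\<mu>\<^sup>2 = 2" for \<mu>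
  proof -
    have "\<bar>\<mu> * ?E \<mu> x\<bar> * \<bar>exp_U (-\<mu>) x\<bar> \<le> (24 * \<delta> * exp (\<mu> * x)) * (12 * exp (- \<mu> * x))"
      using that \<delta> by (intro mult_mono exp_wronskian_bound N exp_pair_bounds) auto
    also have "\<dots> = 288 * \<delta> * (exp (\<mu> * x) * exp (- \<mu> * x))" by simp
    also have "\<dots> = 288 * \<delta>" by (simp flip: exp_add)
    finally show ?thesis by (simp add: abs_mult)
  qed
  have s: "(sqrt 2)\<^sup>2 = (2::real)" "(- sqrt 2)\<^sup>2 = (2::real)" by auto
  have "8 * (U x - a * res_U x) = 4 * (?R x * lin_U x) - 4 * ((?L x - ?L 0) * res_U x)
      - (- sqrt 2) * ?E (- sqrt 2) x * exp_U (- (- sqrt 2)) x - sqrt 2 * ?E (sqrt 2) x * exp_U (- sqrt 2) x"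
    using representation[OF s(1), of x] by (simp add: a_def algebra_simps)
  moreover have "\<bar>?R x * lin_U x\<bar> \<le> 864 * (\<delta> * (1 + \<bar>x\<bar>))"
    using mult_mono[OF R lin_U_bound[of x]] \<delta> by (simp add: abs_mult mult_ac)
  moreover have "\<bar>(?L x - ?L 0) * res_U x\<bar> \<le> 864 * \<delta>"
    using mult_mono[OF L abs_res_U_le[of x]] \<delta> by (simp add: abs_mult mult_ac)
  moreover have "864 * \<delta> \<le> 864 * (\<delta> * (1 + \<bar>x\<bar>))"
    using \<delta> mult_left_mono[of 1 "1 + \<bar>x\<bar>" \<delta>] by simp
  moreover have "8 * \<bar>u\<bar> \<le> 8000 * k"
    if "8 * u = 4 * p - 4 * q - e1 - e2" "\<bar>p\<bar> \<le> 864 * k" "\<bar>q\<bar> \<le> 864 * d" "864 * d \<le> 864 * k"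
      "\<bar>e1\<bar> \<le> 288 * d" "\<bar>e2\<bar> \<le> 288 * d" for u p q e1 e2 k d :: real
    using that by linarith
  ultimately have "8 * \<bar>U x - a * res_U x\<bar> \<le> 8000 * (\<delta> * (1 + \<bar>x\<bar>))"
    using E[OF s(1)] E[OF s(2)] by blast
  then show "\<bar>U x - a * res_U x\<bar> \<le> 1000 * \<delta> * (1 + \<bar>x\<bar>)" by simp
qed

lemma QU_integrable: "integrable lborel (\<lambda>x. Q x * (Q x * U x))"
proof (rule Q_integrable)
  show "continuous_on UNIV (\<lambda>x. Q x * U x)"
    by (intro continuous_intros U_cont)
  show "\<bar>Q x * U x\<bar> \<le> 2 * B * (1 + \<bar>x\<bar>)" for x
  proof -
    have "\<bar>Q x\<bar> * \<bar>U x\<bar> \<le> 2 * B"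
      using Q_le_2[of x] Q_pos[of x] bdd(1)[of x] by (intro mult_mono) auto
    also have "\<dots> \<le> 2 * B * (1 + \<bar>x\<bar>)"
      using B_nonneg mult_left_mono[of 1 "1 + \<bar>x\<bar>" "2 * B"] by simp
    finally show ?thesis by (simp add: abs_mult)
  qed
qed

lemma U_estimate:
  assumes N: "\<And>x. \<bar>N x\<bar> \<le> \<delta>"
  shows "\<bar>U x\<bar> \<le> (\<bar>\<integral>x. Q x * (Q x * U x) \<partial>lborel\<bar> + 10^6 * \<delta>) * (1 + \<bar>x\<bar>)"
proof -
  have \<delta>: "\<delta> \<ge> 0" using N[of 0] by linarith
  obtain a where a: "\<And>x. \<bar>U x - a * res_U x\<bar> \<le> 1000 * \<delta> * (1 + \<bar>x\<bar>)"
    using near_resonance[OF N] by blast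
  have c: "continuous_on UNIV (\<lambda>x. Q x * (U x - a * res_U x))"
    by (intro continuous_intros U_cont)
  have b: "\<bar>Q x * (U x - a * res_U x)\<bar> \<le> 2000 * \<delta> * (1 + \<bar>x\<bar>)" for x
    using mult_mono[OF Q_le_2[of x] a[of x]] Q_pos[of x] by (simp add: abs_mult mult_ac)
  have "(\<integral>x. Q x * (Q x * U x) \<partial>lborel)
      = (\<integral>x. Q x * (Q x * (U x - a * res_U x)) + a * (Q x * (Q x * res_U x)) \<partial>lborel)"
    by (intro Bochner_Integration.integral_cong) (auto simp: algebra_simps)
  also have "\<dots> = (\<integral>x. Q x * (Q x * (U x - a * res_U x)) \<partial>lborel) - 4 / 3 * a"
  proof (subst Bochner_Integration.integral_add)
    show i: "integrable lborel (\<lambda>x. Q x * (Q x * (U x - a * res_U x)))"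
      by (rule Q_integrable[OF c b])
    have "integrable lborel (\<lambda>x. Q x * (Q x * U x) - Q x * (Q x * (U x - a * res_U x)))"
      by (intro Bochner_Integration.integrable_diff QU_integrable i)
    then show "integrable lborel (\<lambda>x. a * (Q x * (Q x * res_U x)))"
      by (simp add: algebra_simps)
  qed (simp add: resonance_integral)
  finally have "4 / 3 * \<bar>a\<bar> \<le> \<bar>\<integral>x. Q x * (Q x * U x) \<partial>lborel\<bar> + 108 * (2000 * \<delta>) * pi"
    using Q_integral_bound[OF c b] by linarith
  also have "108 * (2000 * \<delta>) * pi \<le> 108 * (2000 * \<delta>) * 4"
    using pi_bounds \<delta> by (intro mult_left_mono) auto
  finally have a_le: "\<bar>a\<bar> \<le> \<bar>\<integral>x. Q x * (Q x * U x) \<partial>lborel\<bar> + 864000 * \<delta>"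
    by linarith
  have "\<bar>a * res_U x\<bar> \<le> \<bar>a\<bar> * 1"
    unfolding abs_mult by (intro mult_left_mono abs_res_U_le) auto
  also have "\<dots> \<le> \<bar>a\<bar> * (1 + \<bar>x\<bar>)" by (intro mult_left_mono) auto
  also have "\<dots> \<le> (\<bar>\<integral>x. Q x * (Q x * U x) \<partial>lborel\<bar> + 864000 * \<delta>) * (1 + \<bar>x\<bar>)"
    by (intro mult_right_mono a_le) auto
  finally have "\<bar>U x\<bar> \<le> (\<bar>\<integral>x. Q x * (Q x * U x) \<partial>lborel\<bar> + 864000 * \<delta>) * (1 + \<bar>x\<bar>)
      + 1000 * \<delta> * (1 + \<bar>x\<bar>)"
    using a[of x] by linarith
  also have "\<dots> = (\<bar>\<integral>x. Q x * (Q x * U x) \<partial>lborel\<bar> + 865000 * \<delta>) * (1 + \<bar>x\<bar>)"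
    by (simp add: algebra_simps)
  also have "\<dots> \<le> (\<bar>\<integral>x. Q x * (Q x * U x) \<partial>lborel\<bar> + 10^6 * \<delta>) * (1 + \<bar>x\<bar>)"
    using \<delta> by (intro mult_right_mono) auto
  finally show ?thesis .
qed

text \<open>The Wronskian with the resonance vanishes at both ends, so its derivative has integral zero.\<close>
lemma N_orthogonal_resonance:
  assumes N: "\<And>x. \<bar>N x\<bar> \<le> \<delta>"
  shows "(\<integral>x. Q x * (res_U x * N x) \<partial>lborel) = 0"
proof -
  have "(\<integral>x. Q x * (- N x * res_U x) \<partial>lborel) = 0 - 0"
  proof (rule Q_integral_deriv[OF wronskian_DERIV[OF res.homogeneous_pair_axioms] _ _ res_wronskian_lim])
    show "continuous_on UNIV (\<lambda>x. - N x * res_U x)"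
      by (intro continuous_intros N_cont)
    fix x
    have \<delta>: "\<delta> \<ge> 0" using N[of 0] by linarith
    have "\<bar>N x\<bar> * \<bar>res_U x\<bar> \<le> \<delta> * 1"
      using \<delta> by (intro mult_mono N abs_res_U_le) auto
    also have "\<dots> \<le> \<delta> * (1 + \<bar>x\<bar>)" using \<delta> by (intro mult_left_mono) auto
    finally show "\<bar>- N x * res_U x\<bar> \<le> \<delta> * (1 + \<bar>x\<bar>)" by (simp add: abs_mult)
  qed
  then show ?thesis by (simp add: mult_ac)
qed

text \<open>The pair \<open>(tanh, tanh)\<close> solves the homogeneous system up to the error \<open>2 Q Q'\<close> in \<open>L\<^sub>+ tanh\<close>, and this error is
the term with \<open>U\<close>. Recall that \<open>Q' = - tanh * Q\<close>.\<close>
lemma N_tanh_identity: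
  assumes N: "\<And>x. \<bar>N x\<bar> \<le> \<delta>"
  shows "(\<integral>x. Q x * (tanh x * (N x + 2 * Q x * U x)) \<partial>lborel) = 0"
proof -
  let ?g = "\<lambda>x. W x * (1 - (tanh x)\<^sup>2) + U x * (1 - (tanh x)\<^sup>2) - U' x * tanh x - W' x * tanh x"
  have "(\<integral>x. Q x * (tanh x * (N x + 2 * Q x * U x)) \<partial>lborel) = 0 - 0"
  proof (rule Q_integral_deriv)
    show "DERIV ?g x :> Q x * (tanh x * (N x + 2 * Q x * U x))" for x
    proof -
      have q: "Q x * (Q x * z) = 2 * (1 - tanh x * tanh x) * z" for z
        using Q_sq[of x] by (simp add: power2_eq_square flip: mult.assoc)
      show ?thesis
        by (rule derivative_eq_intros DU DU' DW DW' refl cosh_real_nonzero)+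
           (simp add: q Q_sq algebra_simps power2_eq_square)
    qed
    show "continuous_on UNIV (\<lambda>x. tanh x * (N x + 2 * Q x * U x))"
      by (intro continuous_intros N_cont U_cont) auto
    show "\<bar>tanh x * (N x + 2 * Q x * U x)\<bar> \<le> (\<delta> + 4 * B) * (1 + \<bar>x\<bar>)" for x
    proof -
      have \<delta>: "\<delta> \<ge> 0" using N[of 0] by linarith
      have "\<bar>Q x * U x\<bar> \<le> 2 * B"
        unfolding abs_mult using Q_le_2[of x] Q_pos[of x] bdd(1)[of x] by (intro mult_mono) auto
      then have "\<bar>N x + 2 * Q x * U x\<bar> \<le> \<delta> + 4 * B"
        using N[of x] by (simp only: mult.assoc)
      then have "\<bar>tanh x\<bar> * \<bar>N x + 2 * Q x * U x\<bar> \<le> 1 * (\<delta> + 4 * B)"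
        using abs_tanh_le[of x] by (intro mult_mono) auto
      also have "\<dots> \<le> (\<delta> + 4 * B) * (1 + \<bar>x\<bar>)"
        using \<delta> B_nonneg mult_left_mono[of 1 "1 + \<bar>x\<bar>" "\<delta> + 4 * B"] by simp
      finally show ?thesis by (simp add: abs_mult)
    qed
    have lim: "(?g \<longlongrightarrow> 0) F"
      if "(U' \<longlongrightarrow> 0) F" "(W' \<longlongrightarrow> 0) F" "((\<lambda>x::real. 1 - (tanh x)\<^sup>2) \<longlongrightarrow> 0) F" for F
    proof -
      have "(?g \<longlongrightarrow> 0 + 0 - 0 - 0) F"
        by (intro tendsto_add tendsto_diff tendsto_mult_bounded_0(2)[where B = B]
            tendsto_mult_bounded_0(1)[where B = 1] that bdd abs_tanh_le)
      then show ?thesis by simp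
    qed
    show "(?g \<longlongrightarrow> 0) at_top" "(?g \<longlongrightarrow> 0) at_bot"
      using lim U'_lim W'_lim sech_sq_tendsto_0 by blast+
  qed
  then show ?thesis by simp
qed

end

section \<open>Nonexistence of small classical solutions\<close>

definition bounded_continuous :: "(real \<Rightarrow> real) \<Rightarrow> bool" where
  "bounded_continuous f \<longleftrightarrow> continuous_on UNIV f \<and> (\<exists>M. \<forall>x. \<bar>f x\<bar> \<le> M)"

lemma bcI: "continuous_on UNIV f \<Longrightarrow> (\<And>x. \<bar>f x\<bar> \<le> M) \<Longrightarrow> bounded_continuous f"
  by (auto simp: bounded_continuous_def)

lemma bc_const: "bounded_continuous (\<lambda>x. c)"
  by (rule bcI[of _ "\<bar>c\<bar>"]) auto

lemma bc_add:
  assumes "bounded_continuous f" "bounded_continuous g"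
  shows "bounded_continuous (\<lambda>x. f x + g x)"
proof -
  obtain M M' where "continuous_on UNIV f" "continuous_on UNIV g" "\<And>x. \<bar>f x\<bar> \<le> M" "\<And>x. \<bar>g x\<bar> \<le> M'"
    using assms by (auto simp: bounded_continuous_def)
  then show ?thesis
    by (intro bcI[of _ "M + M'"] continuous_intros) (auto intro: order_trans[OF abs_triangle_ineq] add_mono)
qed

lemma bc_mult:
  assumes "bounded_continuous f" "bounded_continuous g"
  shows "bounded_continuous (\<lambda>x. f x * g x)"
proof -
  obtain M M' where c: "continuous_on UNIV f" "continuous_on UNIV g"
    and M: "\<And>x. \<bar>f x\<bar> \<le> M" "\<And>x. \<bar>g x\<bar> \<le> M'"
    using assms by (auto simp: bounded_continuous_def)
  have "\<bar>f x * g x\<bar> \<le> M * M'" for x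
    unfolding abs_mult using M(1)[of x] by (intro mult_mono M) auto
  then show ?thesis
    by (intro bcI continuous_intros c)
qed

lemma bc_tanh: "bounded_continuous tanh"
  by (rule bcI[of _ 1]) (auto intro!: continuous_intros abs_tanh_le)

lemma bc_res_U: "bounded_continuous res_U"
  by (rule bcI[of _ 1]) (auto intro!: continuous_intros abs_res_U_le)

lemma bc_Q: "bounded_continuous Q"
  using Q_le_2 Q_pos by (intro bcI[of _ 2]) (auto intro!: continuous_intros simp: abs_of_pos)

lemmas bc_intros = bc_const bc_add bc_mult bc_tanh bc_res_U bc_Q

lemma bc_weighted: "bounded_continuous f \<Longrightarrow> \<exists>M. \<forall>x. \<bar>f x\<bar> \<le> M * (1 + \<bar>x\<bar>)"
proof -
  assume "bounded_continuous f"
  then obtain M where M: "\<And>x. \<bar>f x\<bar> \<le> M"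
    by (auto simp: bounded_continuous_def)
  have "M \<ge> 0" using M[of 0] by linarith
  then have "M * 1 \<le> M * (1 + \<bar>x\<bar>)" for x
    by (intro mult_left_mono) auto
  then have "\<bar>f x\<bar> \<le> M * (1 + \<bar>x\<bar>)" for x
    using order_trans[OF M[of x]] by simp
  then show ?thesis by blast
qed

text \<open>All pairings below carry the factor \<open>Q\<close>, which makes them converge for bounded functions.\<close>
definition Q_int :: "(real \<Rightarrow> real) \<Rightarrow> real" where
  "Q_int k = (\<integral>x. Q x * k x \<partial>lborel)"

lemma bc_integrable: "bounded_continuous k \<Longrightarrow> integrable lborel (\<lambda>x. Q x * k x)"
  using bc_weighted Q_integrable unfolding bounded_continuous_def by metis

lemma Q_int_add:
  "bounded_continuous f \<Longrightarrow> bounded_continuous g \<Longrightarrow> Q_int (\<lambda>x. f x + g x) = Q_int f + Q_int g"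
  by (simp add: Q_int_def distrib_left bc_integrable)

lemma Q_int_cmult: "Q_int (\<lambda>x. c * f x) = c * Q_int f"
  by (simp add: Q_int_def mult.left_commute[of _ c])

lemma Q_int_deriv_zero:
  assumes h: "bounded_continuous h" and k: "bounded_continuous k"
    and D: "\<And>x. DERIV (\<lambda>x. Q x * h x) x :> Q x * k x"
  shows "Q_int k = 0"
proof -
  obtain M where M: "\<And>x. \<bar>k x\<bar> \<le> M * (1 + \<bar>x\<bar>)"
    using bc_weighted[OF k] by blast
  obtain B where B: "\<And>x. \<bar>h x\<bar> \<le> B"
    using h by (auto simp: bounded_continuous_def)
  have "(\<integral>x. Q x * k x \<partial>lborel) = 0 - 0"
    using k tendsto_mult_bounded_0(1)[OF Q_tendsto_0(1) B] tendsto_mult_bounded_0(1)[OF Q_tendsto_0(2) B]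
    by (intro Q_integral_deriv[OF D _ M]) (auto simp: bounded_continuous_def)
  then show ?thesis by (simp add: Q_int_def)
qed

text \<open>Integration by parts against \<open>Q\<close> and \<open>Q'\<close>, with \<open>Q' = - tanh * Q\<close> and \<open>Q'' = Q (1 - Q\<^sup>2) = Q * res_U\<close>.\<close>
lemma Q_int_by_parts:
  assumes f: "bounded_continuous f" and f': "bounded_continuous f'" and D: "\<And>x. DERIV f x :> f' x"
  shows "Q_int (\<lambda>x. tanh x * f x) = Q_int f'"
    and "Q_int (\<lambda>x. res_U x * f x) = Q_int (\<lambda>x. tanh x * f' x)"
proof -
  have "Q_int (\<lambda>x. (-1) * (tanh x * f x) + f' x) = 0"
  proof (rule Q_int_deriv_zero[OF f])
    show "bounded_continuous (\<lambda>x. (-1) * (tanh x * f x) + f' x)"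
      by (intro bc_intros f f')
    show "DERIV (\<lambda>x. Q x * f x) x :> Q x * ((-1) * (tanh x * f x) + f' x)" for x
      by (rule derivative_eq_intros D refl)+ (simp add: algebra_simps)
  qed
  moreover have "Q_int (\<lambda>x. (-1) * (tanh x * f x) + f' x) = (-1) * Q_int (\<lambda>x. tanh x * f x) + Q_int f'"
    by (subst Q_int_add) (intro bc_intros f f' | simp only: Q_int_cmult)+
  ultimately show "Q_int (\<lambda>x. tanh x * f x) = Q_int f'" by simp
  have "Q_int (\<lambda>x. (-1) * (res_U x * f x) + tanh x * f' x) = 0"
  proof (rule Q_int_deriv_zero)
    show "bounded_continuous (\<lambda>x. tanh x * f x)"
      by (intro bc_intros f)
    show "bounded_continuous (\<lambda>x. (-1) * (res_U x * f x) + tanh x * f' x)"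
      by (intro bc_intros f f')
    show "DERIV (\<lambda>x. Q x * (tanh x * f x)) x :> Q x * ((-1) * (res_U x * f x) + tanh x * f' x)" for x
      by (rule derivative_eq_intros D refl cosh_real_nonzero)+
         (simp add: res_U_def algebra_simps power2_eq_square)
  qed
  moreover have "Q_int (\<lambda>x. (-1) * (res_U x * f x) + tanh x * f' x)
      = (-1) * Q_int (\<lambda>x. res_U x * f x) + Q_int (\<lambda>x. tanh x * f' x)"
    by (subst Q_int_add) (intro bc_intros f f' | simp only: Q_int_cmult)+
  ultimately show "Q_int (\<lambda>x. res_U x * f x) = Q_int (\<lambda>x. tanh x * f' x)" by simp
qed

text \<open>The indices 1 and 2 distinguish the two trigonometric components, which drive each other through the
transport equations. By the orthogonality to the resonance and the identity with \<open>tanh\<close>, first \<open>V1\<close> and then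
\<open>V2 - \<beta> * N2\<close> acquire vanishing pairings, with \<open>Q''\<close> and \<open>Q'\<close> respectively; a last integration by parts brings in the
source of the equation for \<open>V2 - \<beta> * N2\<close>.\<close>
lemma averaged_source_zero:
  fixes \<sigma> :: real
  assumes sol1: "forced_solution U1 U1' W1 W1' N1 B" and sol2: "forced_solution U2 U2' W2 W2' N2 B"
    and \<sigma>: "\<sigma> \<noteq> 0"
    and VN1: "\<And>x. DERIV (\<lambda>x. V1 x - \<beta> * N1 x) x :> \<sigma> * (N2 x + 2 * Q x * U2 x)"
    and NV1: "\<And>x. DERIV (\<lambda>x. N1 x - \<beta> * V1 x) x :> \<sigma> * (V2 x + 2 * \<beta> * Q x * U2 x)"
    and VN2: "\<And>x. DERIV (\<lambda>x. V2 x - \<beta> * N2 x) x :> - \<sigma> * (N1 x + 2 * Q x * U1 x)"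
    and N1: "bounded_continuous N1" and V1: "bounded_continuous V1"
    and N2: "bounded_continuous N2" and V2: "bounded_continuous V2"
  shows "Q_int (\<lambda>x. N1 x + 2 * Q x * U1 x) = 0"
proof -
  interpret s1: forced_solution U1 U1' W1 W1' N1 B by (rule sol1)
  interpret s2: forced_solution U2 U2' W2 W2' N2 B by (rule sol2)
  have U: "bounded_continuous U1" "bounded_continuous U2"
    using s1.bdd(1) s2.bdd(1) by (auto intro!: bcI s1.U_cont s2.U_cont)
  obtain M1 M2 where M: "\<And>x. \<bar>N1 x\<bar> \<le> M1" "\<And>x. \<bar>N2 x\<bar> \<le> M2"
    using N1 N2 by (auto simp: bounded_continuous_def)
  note bc = bc_intros U N1 N2 V1 V2
  have a: "Q_int (\<lambda>x. res_U x * N1 x) = 0"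
    using s1.N_orthogonal_resonance[OF M(1)] by (simp add: Q_int_def)
  have b: "Q_int (\<lambda>x. tanh x * (N2 x + 2 * Q x * U2 x)) = 0"
    using s2.N_tanh_identity[OF M(2)] by (simp add: Q_int_def)
  have bc_diff: "bounded_continuous (\<lambda>x. f x - \<beta> * g x)"
    if "bounded_continuous f" "bounded_continuous g" for f g
  proof -
    have "bounded_continuous (\<lambda>x. f x + (- \<beta>) * g x)"
      by (intro bc that)
    then show ?thesis by simp
  qed
  have diff: "Q_int (\<lambda>x. h x * (f x - \<beta> * g x)) = Q_int (\<lambda>x. h x * f x) - \<beta> * Q_int (\<lambda>x. h x * g x)"
    if "bounded_continuous f" "bounded_continuous g" "bounded_continuous h" for f g h
  proof -
    have "Q_int (\<lambda>x. h x * f x + (- \<beta>) * (h x * g x)) = Q_int (\<lambda>x. h x * f x) + (- \<beta>) * Q_int (\<lambda>x. h x * g x)"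
      by (subst Q_int_add) (intro bc that | simp only: Q_int_cmult)+
    then show "Q_int (\<lambda>x. h x * (f x - \<beta> * g x)) = Q_int (\<lambda>x. h x * f x) - \<beta> * Q_int (\<lambda>x. h x * g x)"
      by (simp add: algebra_simps)
  qed
  have "Q_int (\<lambda>x. res_U x * (V1 x - \<beta> * N1 x)) = Q_int (\<lambda>x. tanh x * (\<sigma> * (N2 x + 2 * Q x * U2 x)))"
    by (intro Q_int_by_parts(2) VN1 bc_diff bc)
  also have "\<dots> = \<sigma> * Q_int (\<lambda>x. tanh x * (N2 x + 2 * Q x * U2 x))"
    by (simp add: mult.left_commute[of _ \<sigma>] flip: Q_int_cmult)
  finally have c: "Q_int (\<lambda>x. res_U x * V1 x) = 0"
    using a b by (simp add: diff bc)
  have "Q_int (\<lambda>x. res_U x * (N1 x - \<beta> * V1 x)) = Q_int (\<lambda>x. tanh x * (\<sigma> * (V2 x + 2 * \<beta> * Q x * U2 x)))"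
    by (intro Q_int_by_parts(2) NV1 bc_diff bc)
  also have "\<dots> = \<sigma> * Q_int (\<lambda>x. tanh x * (V2 x + 2 * \<beta> * Q x * U2 x))"
    by (simp add: mult.left_commute[of _ \<sigma>] flip: Q_int_cmult)
  finally have d: "Q_int (\<lambda>x. tanh x * (V2 x + 2 * \<beta> * Q x * U2 x)) = 0"
    using a c \<sigma> by (simp add: diff bc)
  have "Q_int (\<lambda>x. tanh x * ((V2 x + 2 * \<beta> * Q x * U2 x) - \<beta> * (N2 x + 2 * Q x * U2 x))) = 0"
    by (subst diff) (intro bc | simp only: b d)+
  then have "Q_int (\<lambda>x. tanh x * (V2 x - \<beta> * N2 x)) = 0"
    by (simp add: algebra_simps)
  moreover have "Q_int (\<lambda>x. tanh x * (V2 x - \<beta> * N2 x)) = Q_int (\<lambda>x. - \<sigma> * (N1 x + 2 * Q x * U1 x))"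
    by (intro Q_int_by_parts(1) VN2 bc_diff bc)
  ultimately show ?thesis
    using \<sigma> by (simp only: Q_int_cmult) simp
qed

text \<open>Without forcing, \<open>(p, q)\<close> rotates with speed \<open>\<kappa>\<close>. The component \<open>r\<close> of \<open>(p, q)\<close> in a frame that rotates along
and agrees with \<open>p\<close> at the point \<open>x\<close> has only the forcing in its derivative.\<close>
lemma rotating_pair_bound:
  fixes \<kappa> \<alpha> m :: real
  assumes Dp: "\<And>x. DERIV p x :> - \<kappa> * (q x + \<alpha> * Q x * s x)"
    and Dq: "\<And>x. DERIV q x :> \<kappa> * (p x + \<alpha> * Q x * c x)"
    and p: "(p \<longlongrightarrow> 0) at_top" and q: "(q \<longlongrightarrow> 0) at_top"
    and c: "\<And>x. \<bar>c x\<bar> \<le> m * (1 + \<bar>x\<bar>)" and s: "\<And>x. \<bar>s x\<bar> \<le> m * (1 + \<bar>x\<bar>)"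
  shows "\<bar>p x\<bar> \<le> 864 * \<bar>\<kappa> * \<alpha>\<bar> * m"
proof -
  define r where "r t = p t * cos (\<kappa> * (t - x)) + q t * sin (\<kappa> * (t - x))" for t
  define k where "k t = \<kappa> * \<alpha> * (c t * sin (\<kappa> * (t - x)) - s t * cos (\<kappa> * (t - x)))" for t
  have D: "DERIV r t :> Q t * k t" for t
    unfolding r_def[abs_def] k_def
    by (rule derivative_eq_intros Dp Dq refl)+ (simp add: algebra_simps)
  have k: "\<bar>k t\<bar> \<le> 2 * \<bar>\<kappa> * \<alpha>\<bar> * m * (1 + \<bar>t\<bar>)" for t
  proof -
    have m: "0 \<le> m * (1 + \<bar>t\<bar>)" using c[of t] by linarith
    have "\<bar>c t * sin (\<kappa> * (t - x)) - s t * cos (\<kappa> * (t - x))\<bar>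
        \<le> \<bar>c t\<bar> * \<bar>sin (\<kappa> * (t - x))\<bar> + \<bar>s t\<bar> * \<bar>cos (\<kappa> * (t - x))\<bar>"
      using abs_triangle_ineq4[of "c t * sin (\<kappa> * (t - x))" "s t * cos (\<kappa> * (t - x))"]
      by (simp add: abs_mult)
    also have "\<dots> \<le> m * (1 + \<bar>t\<bar>) * 1 + m * (1 + \<bar>t\<bar>) * 1"
      using m by (intro add_mono mult_mono c s abs_sin_le_one abs_cos_le_one) auto
    finally have "\<bar>\<kappa> * \<alpha>\<bar> * \<bar>c t * sin (\<kappa> * (t - x)) - s t * cos (\<kappa> * (t - x))\<bar>
        \<le> \<bar>\<kappa> * \<alpha>\<bar> * (2 * (m * (1 + \<bar>t\<bar>)))"
      by (intro mult_left_mono) auto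
    then show ?thesis by (simp add: k_def abs_mult mult_ac)
  qed
  have "(r \<longlongrightarrow> 0 + 0) at_top"
    unfolding r_def[abs_def]
    by (intro tendsto_add tendsto_mult_bounded_0(1)[OF p abs_cos_le_one] tendsto_mult_bounded_0(1)[OF q abs_sin_le_one])
  then have "\<bar>r x\<bar> \<le> 108 * (2 * \<bar>\<kappa> * \<alpha>\<bar> * m) * 4"
    by (intro arctan_bound[OF D Q_mult_bound[OF k]]) simp
  then show ?thesis by (simp add: r_def)
qed

text \<open>Here \<open>\<epsilon>\<close> is \<open>\<surd>\<omega>\<close>, the first triple consists of \<open>C\<^sub>1, -S\<^sub>2, C\<^sub>N\<close> and the second of \<open>S\<^sub>1, C\<^sub>2, S\<^sub>N\<close>, while \<open>V\<close> and \<open>Y\<close>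
are \<open>C\<^sub>V\<close> and \<open>S\<^sub>V\<close>. A weighted bound \<open>m\<close> on \<open>C\<close> and \<open>S\<close> makes \<open>N, M, V, Y\<close> of size \<open>\<epsilon> m\<close>; the averaged identity
then makes \<open>\<integral> Q\<^sup>2 C\<close> and \<open>\<integral> Q\<^sup>2 S\<close> of this size, and the a priori estimate returns the bound \<open>m / 2\<close>.\<close>
theorem no_classical_solution:
  fixes \<beta> \<epsilon> :: real
  assumes \<beta>: "-1 < \<beta>" "\<beta> < 1" and \<epsilon>: "0 < \<epsilon>" "10^11 * \<epsilon> \<le> 1 - \<beta>\<^sup>2"
    and solC: "forced_solution C C' WC WC' N B" and solS: "forced_solution S S' WS WS' M B"
    and VN: "\<And>x. DERIV (\<lambda>x. V x - \<beta> * N x) x :> - \<epsilon> * (M x + 2 * Q x * S x)"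
    and YM: "\<And>x. DERIV (\<lambda>x. Y x - \<beta> * M x) x :> \<epsilon> * (N x + 2 * Q x * C x)"
    and NV: "\<And>x. DERIV (\<lambda>x. N x - \<beta> * V x) x :> - \<epsilon> * (Y x + 2 * \<beta> * Q x * S x)"
    and MY: "\<And>x. DERIV (\<lambda>x. M x - \<beta> * Y x) x :> \<epsilon> * (V x + 2 * \<beta> * Q x * C x)"
    and bc: "bounded_continuous N" "bounded_continuous M" "bounded_continuous V" "bounded_continuous Y"
    and lim: "(N \<longlongrightarrow> 0) at_top" "(M \<longlongrightarrow> 0) at_top" "(V \<longlongrightarrow> 0) at_top" "(Y \<longlongrightarrow> 0) at_top"
  shows "C x = 0" "S x = 0" "WC x = 0" "WS x = 0" "N x = 0" "M x = 0" "V x = 0" "Y x = 0"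
proof -
  interpret c: forced_solution C C' WC WC' N B by (rule solC)
  interpret s: forced_solution S S' WS WS' M B by (rule solS)
  have \<beta>2: "0 < 1 - \<beta>\<^sup>2" "(1 - \<beta>) * (1 + \<beta>) = 1 - \<beta>\<^sup>2"
    using \<beta> by (auto simp: abs_square_less_1 power2_eq_square algebra_simps)
       (metis abs_less_iff abs_square_less_1 minus_less_iff power2_eq_square)
  have avC: "Q_int (\<lambda>x. N x + 2 * Q x * C x) = 0"
    using \<epsilon> by (intro averaged_source_zero[OF solC solS _ VN NV _ bc(1,3,2,4)]) (auto simp: YM)
  have avS: "Q_int (\<lambda>x. M x + 2 * Q x * S x) = 0"
    using \<epsilon> by (intro averaged_source_zero[OF solS solC _ YM MY VN bc(2,4,1,3)]) auto
  define D where "D = \<epsilon> / (1 - \<beta>\<^sup>2)"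
  have D: "0 \<le> D" "10^11 * D \<le> 1"
    using \<beta>2 \<epsilon> by (auto simp: D_def field_simps)
  \<comment> \<open>the sums and the differences diagonalize the transport part, with speeds \<open>\<epsilon> / (1 - \<beta>)\<close> and \<open>- \<epsilon> / (1 + \<beta>)\<close>\<close>
  have plus: "DERIV (\<lambda>x. N x + V x) x :> - (\<epsilon> / (1 - \<beta>)) * ((M x + Y x) + 2 * (1 + \<beta>) * Q x * S x)"
    "DERIV (\<lambda>x. M x + Y x) x :> \<epsilon> / (1 - \<beta>) * ((N x + V x) + 2 * (1 + \<beta>) * Q x * C x)" for x
  proof -
    have e: "(\<lambda>x. f x + g x) = (\<lambda>x. ((f x - \<beta> * g x) + (g x - \<beta> * f x)) / (1 - \<beta>))" for f g :: "real \<Rightarrow> real"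
      using \<beta> by (auto simp: field_simps)
    show "DERIV (\<lambda>x. N x + V x) x :> - (\<epsilon> / (1 - \<beta>)) * ((M x + Y x) + 2 * (1 + \<beta>) * Q x * S x)"
      unfolding e[of N V]
      by (rule DERIV_cong[OF DERIV_cdivide[OF DERIV_add[OF NV VN]]])
         (use \<beta> in \<open>simp add: divide_simps\<close>, simp add: algebra_simps)
    show "DERIV (\<lambda>x. M x + Y x) x :> \<epsilon> / (1 - \<beta>) * ((N x + V x) + 2 * (1 + \<beta>) * Q x * C x)"
      unfolding e[of M Y]
      by (rule DERIV_cong[OF DERIV_cdivide[OF DERIV_add[OF MY YM]]])
         (use \<beta> in \<open>simp add: divide_simps\<close>, simp add: algebra_simps)
  qed
  have minus: "DERIV (\<lambda>x. N x - V x) x :> - (- \<epsilon> / (1 + \<beta>)) * ((M x - Y x) + 2 * (1 - \<beta>) * Q x * S x)"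
    "DERIV (\<lambda>x. M x - Y x) x :> (- \<epsilon> / (1 + \<beta>)) * ((N x - V x) + 2 * (1 - \<beta>) * Q x * C x)" for x
  proof -
    have e: "(\<lambda>x. f x - g x) = (\<lambda>x. ((f x - \<beta> * g x) - (g x - \<beta> * f x)) / (1 + \<beta>))" for f g :: "real \<Rightarrow> real"
      using \<beta> by (auto simp: field_simps)
    show "DERIV (\<lambda>x. N x - V x) x :> - (- \<epsilon> / (1 + \<beta>)) * ((M x - Y x) + 2 * (1 - \<beta>) * Q x * S x)"
      unfolding e[of N V]
      by (rule DERIV_cong[OF DERIV_cdivide[OF DERIV_diff[OF NV VN]]])
         (use \<beta> in \<open>simp add: divide_simps\<close>, simp add: algebra_simps)
    show "DERIV (\<lambda>x. M x - Y x) x :> (- \<epsilon> / (1 + \<beta>)) * ((N x - V x) + 2 * (1 - \<beta>) * Q x * C x)"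
      unfolding e[of M Y]
      by (rule DERIV_cong[OF DERIV_cdivide[OF DERIV_diff[OF MY YM]]])
         (use \<beta> in \<open>simp add: divide_simps\<close>, simp add: algebra_simps)
  qed
  have coeff: "\<bar>\<epsilon> / (1 - \<beta>) * (2 * (1 + \<beta>))\<bar> \<le> 8 * D" "\<bar>- \<epsilon> / (1 + \<beta>) * (2 * (1 - \<beta>))\<bar> \<le> 8 * D"
  proof -
    have sq: "(1 + \<beta>)\<^sup>2 \<le> 4" "(1 - \<beta>)\<^sup>2 \<le> 4"
      using \<beta> power_mono[of "1 + \<beta>" 2 2] power_mono[of "1 - \<beta>" 2 2] by simp_all
    have "\<epsilon> / (1 - \<beta>) * (2 * (1 + \<beta>)) = 2 * D * (1 + \<beta>)\<^sup>2" "\<epsilon> / (1 + \<beta>) * (2 * (1 - \<beta>)) = 2 * D * (1 - \<beta>)\<^sup>2"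
      unfolding D_def \<beta>2(2)[symmetric] using \<beta> by (simp_all add: divide_simps power2_eq_square)
    then show "\<bar>\<epsilon> / (1 - \<beta>) * (2 * (1 + \<beta>))\<bar> \<le> 8 * D" "\<bar>- \<epsilon> / (1 + \<beta>) * (2 * (1 - \<beta>))\<bar> \<le> 8 * D"
      using mult_left_mono[OF sq(1), of "2 * D"] mult_left_mono[OF sq(2), of "2 * D"] D(1) \<epsilon>(1) \<beta>
      by (simp_all add: abs_mult)
  qed
  have small: "\<bar>N x\<bar> \<le> 7000 * D * m \<and> \<bar>M x\<bar> \<le> 7000 * D * m \<and> \<bar>V x\<bar> \<le> 7000 * D * m \<and> \<bar>Y x\<bar> \<le> 7000 * D * m"
    if m: "\<And>x. \<bar>C x\<bar> \<le> m * (1 + \<bar>x\<bar>)" "\<And>x. \<bar>S x\<bar> \<le> m * (1 + \<bar>x\<bar>)" for m x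
  proof -
    have m0: "0 \<le> m" using m(1)[of 0] by simp
    have l: "((\<lambda>x. f x + g x) \<longlongrightarrow> 0) at_top" "((\<lambda>x. f x - g x) \<longlongrightarrow> 0) at_top"
      if "(f \<longlongrightarrow> 0) at_top" "(g \<longlongrightarrow> 0) at_top" for f g :: "real \<Rightarrow> real"
      using tendsto_add[OF that] tendsto_diff[OF that] by simp_all
    have pair: "\<bar>p x\<bar> \<le> 7000 * D * m \<and> \<bar>q x\<bar> \<le> 7000 * D * m"
      if Dp: "\<And>x. DERIV p x :> - \<kappa> * (q x + \<alpha> * Q x * S x)"
        and Dq: "\<And>x. DERIV q x :> \<kappa> * (p x + \<alpha> * Q x * C x)"
        and pq: "(p \<longlongrightarrow> 0) at_top" "(q \<longlongrightarrow> 0) at_top" and \<kappa>: "\<bar>\<kappa> * \<alpha>\<bar> \<le> 8 * D" for p q \<kappa> \<alpha>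
    proof -
      have le: "864 * \<bar>\<kappa> * \<alpha>\<bar> * m \<le> 7000 * D * m"
        using \<kappa> D(1) m0 by (intro mult_right_mono) auto
      have "\<bar>p x\<bar> \<le> 864 * \<bar>\<kappa> * \<alpha>\<bar> * m"
        by (rule rotating_pair_bound[OF Dp Dq pq m])
      moreover have "\<bar>q x\<bar> \<le> 864 * \<bar>\<kappa> * \<alpha>\<bar> * m"
      proof (rule rotating_pair_bound[where p = q and q = "\<lambda>x. - p x" and \<kappa> = \<kappa> and \<alpha> = \<alpha> and s = "\<lambda>x. - C x" and c = S])
        show "DERIV q x :> - \<kappa> * (- p x + \<alpha> * Q x * - C x)" for x
          by (rule DERIV_cong[OF Dq]) (simp add: algebra_simps)
        show "DERIV (\<lambda>x. - p x) x :> \<kappa> * (q x + \<alpha> * Q x * S x)" for x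
          by (rule DERIV_cong[OF DERIV_minus[OF Dp]]) simp
        show "((\<lambda>x. - p x) \<longlongrightarrow> 0) at_top"
          using tendsto_minus[OF pq(1)] by simp
      qed (use pq m in auto)
      ultimately show ?thesis using le by linarith
    qed
    from pair[OF plus l(1)[OF lim(1,3)] l(1)[OF lim(2,4)] coeff(1)]
      pair[OF minus l(2)[OF lim(1,3)] l(2)[OF lim(2,4)] coeff(2)]
    show ?thesis by linarith
  qed
  have step: "\<bar>U x\<bar> \<le> m / 2 * (1 + \<bar>x\<bar>)"
    if sol: "forced_solution U U' W W' F B" and av: "Q_int (\<lambda>x. F x + 2 * Q x * U x) = 0"
      and F: "bounded_continuous F" "\<And>x. \<bar>F x\<bar> \<le> 7000 * D * m" for U U' W W' F m x
  proof -
    interpret u: forced_solution U U' W W' F B by (rule sol)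
    have Dm: "0 \<le> 7000 * D * m" using F(2)[of 0] by linarith
    have U: "bounded_continuous U"
      using u.bdd(1) by (auto intro!: bcI u.U_cont)
    have "Q_int (\<lambda>x. F x + 2 * (Q x * U x)) = Q_int F + 2 * Q_int (\<lambda>x. Q x * U x)"
      by (subst Q_int_add) (intro bc_intros F U | simp only: Q_int_cmult)+
    then have "\<bar>Q_int (\<lambda>x. Q x * U x)\<bar> \<le> \<bar>Q_int F\<bar>"
      using av by (simp add: mult.assoc)
    also have "\<bar>Q_int F\<bar> \<le> 108 * (7000 * D * m) * pi"
    proof -
      have "7000 * D * m * 1 \<le> 7000 * D * m * (1 + \<bar>x\<bar>)" for x
        by (rule mult_left_mono[OF _ Dm]) auto
      then have "\<bar>F x\<bar> \<le> 7000 * D * m * (1 + \<bar>x\<bar>)" for x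
        using order_trans[OF F(2)[of x]] by simp
      then show ?thesis
        unfolding Q_int_def using F(1) by (intro Q_integral_bound) (auto simp: bounded_continuous_def)
    qed
    also have "\<dots> \<le> 108 * (7000 * D * m) * 4"
      using pi_bounds Dm by (intro mult_left_mono) auto
    finally have "\<bar>\<integral>x. Q x * (Q x * U x) \<partial>lborel\<bar> + 10^6 * (7000 * D * m) \<le> 2 * 10^6 * (7000 * D * m)"
      using Dm by (simp add: Q_int_def)
    also have "\<dots> \<le> m / 2"
    proof -
      have m0: "0 \<le> m \<or> D = 0" using Dm D(1) by (auto simp: zero_le_mult_iff)
      show ?thesis
      proof (cases "0 \<le> m")
        case True
        then show ?thesis using mult_right_mono[OF D(2), of m] D(1) by simp
      next
        case False
        then show ?thesis using m0 \<epsilon> \<beta>2 by (auto simp: D_def)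
      qed
    qed
    finally show ?thesis
      using u.U_estimate[OF F(2), of x] mult_right_mono[of _ "m / 2" "1 + \<bar>x\<bar>"]
      by (smt (verit) abs_ge_zero)
  qed
  have iter: "\<forall>x. \<bar>C x\<bar> \<le> B / 2 ^ n * (1 + \<bar>x\<bar>) \<and> \<bar>S x\<bar> \<le> B / 2 ^ n * (1 + \<bar>x\<bar>)" for n :: nat
  proof (induction n)
    case 0
    have "B * 1 \<le> B * (1 + \<bar>x\<bar>)" for x
      using c.B_nonneg by (intro mult_left_mono) auto
    then have "\<bar>C x\<bar> \<le> B * (1 + \<bar>x\<bar>) \<and> \<bar>S x\<bar> \<le> B * (1 + \<bar>x\<bar>)" for x
      using order_trans[OF c.bdd(1)[of x]] order_trans[OF s.bdd(1)[of x]] by simp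
    then show ?case by simp
  next
    case (Suc n)
    then have le: "\<bar>C x\<bar> \<le> B / 2 ^ n * (1 + \<bar>x\<bar>)" "\<bar>S x\<bar> \<le> B / 2 ^ n * (1 + \<bar>x\<bar>)" for x
      by auto
    have "\<bar>N x\<bar> \<le> 7000 * D * (B / 2 ^ n)" "\<bar>M x\<bar> \<le> 7000 * D * (B / 2 ^ n)" for x
      using small[OF le] by auto
    then have "\<bar>C x\<bar> \<le> B / 2 ^ n / 2 * (1 + \<bar>x\<bar>)" "\<bar>S x\<bar> \<le> B / 2 ^ n / 2 * (1 + \<bar>x\<bar>)" for x
      using step[OF solC avC bc(1)] step[OF solS avS bc(2)] by blast+
    then show ?case by (simp add: mult.commute)
  qed
  have zero: "C x = 0 \<and> S x = 0" for x
  proof -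
    have "(\<lambda>n. B / 2 ^ n * (1 + \<bar>x\<bar>)) \<longlonglongrightarrow> 0 * (1 + \<bar>x\<bar>)"
      by (intro tendsto_intros LIMSEQ_divide_realpow_zero) auto
    then have lim0: "(\<lambda>n. B / 2 ^ n * (1 + \<bar>x\<bar>)) \<longlonglongrightarrow> 0" by simp
    have "\<bar>C x\<bar> \<le> 0"
      by (rule LIMSEQ_le_const[OF lim0]) (use iter in blast)
    moreover have "\<bar>S x\<bar> \<le> 0"
      by (rule LIMSEQ_le_const[OF lim0]) (use iter in blast)
    ultimately show ?thesis by simp
  qed
  have "\<bar>N x\<bar> \<le> 7000 * D * 0 \<and> \<bar>M x\<bar> \<le> 7000 * D * 0 \<and> \<bar>V x\<bar> \<le> 7000 * D * 0 \<and> \<bar>Y x\<bar> \<le> 7000 * D * 0" for x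
    by (rule small) (simp_all add: zero)
  then have NMVY: "N x = 0" "M x = 0" "V x = 0" "Y x = 0" for x by auto
  have W0: "W x = 0"
    if sol: "forced_solution U U' W W' F B" and U: "\<And>x. U x = 0" and F: "\<And>x. F x = 0" for U U' W W' F x
  proof -
    interpret u: forced_solution U U' W W' F B by (rule sol)
    have "U = (\<lambda>_. 0)" using U by auto
    then have "U' x = 0" for x
      using u.DU[of x] DERIV_unique[of U "U' x" x 0] by simp
    then have "U' = (\<lambda>_. 0)" by auto
    then show ?thesis
      using u.DU'[of x] DERIV_unique[OF u.DU'[of x], of 0] U F by simp
  qed
  show "C x = 0" "S x = 0" "WC x = 0" "WS x = 0" "N x = 0" "M x = 0" "V x = 0" "Y x = 0"
    using zero NMVY W0[OF solC] W0[OF solS] by auto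
qed

section \<open>Regularity of distributional solutions\<close>

text \<open>Completeness of Lebesgue measure gives equality even at arguments where the integrand is not measurable, so the
two distributions are equal as functions.\<close>
lemma dist_of_cong_AE:
  assumes "AE y in lebesgue. f y = g y"
  shows "dist_of f = dist_of g"
proof
  fix \<phi>
  have ae: "AE y in lebesgue. f y * \<phi> y = g y * \<phi> y" "AE y in lebesgue. g y * \<phi> y = f y * \<phi> y"
    using assms by (auto elim!: eventually_mono)
  have "(\<integral>y. f y * \<phi> y \<partial>lebesgue) = (\<integral>y. g y * \<phi> y \<partial>lebesgue)"
  proof (cases "(\<lambda>y. f y * \<phi> y) \<in> borel_measurable lebesgue")
    case True
    then show ?thesis
      using borel_measurable_AE[OF True ae(1)] ae(1) by (intro integral_cong_AE)
  next
    case False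
    then have "(\<lambda>y. g y * \<phi> y) \<notin> borel_measurable lebesgue"
      using borel_measurable_AE[OF _ ae(2)] by blast
    then show ?thesis
      using False by (metis borel_measurable_integrable not_integrable_integral_eq)
  qed
  then show "dist_of f \<phi> = dist_of g \<phi>" by (simp add: dist_of_def)
qed

lemma L2_AE:
  assumes f: "f \<in> L2" and ae: "AE x in lebesgue. f x = g x"
  shows "g \<in> L2"
proof -
  have g: "g \<in> borel_measurable lebesgue"
    using f borel_measurable_AE[OF _ ae] by (simp add: L2_def)
  have "integrable lebesgue (\<lambda>y. (g y)\<^sup>2)"
  proof (rule integrable_cong_AE_imp)
    show "integrable lebesgue (\<lambda>y. (f y)\<^sup>2)" using f by (simp add: L2_def)
    show "(\<lambda>y. (g y)\<^sup>2) \<in> borel_measurable lebesgue" using g by measurable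
    show "AE x in lebesgue. (f x)\<^sup>2 = (g x)\<^sup>2" using ae by eventually_elim simp
  qed
  then show ?thesis using g by (simp add: L2_def)
qed

lemma L2_scale: "f \<in> L2 \<Longrightarrow> (\<lambda>x. c * f x) \<in> L2"
  by (auto simp: L2_def power_mult_distrib)

lemma L2_add:
  assumes "f \<in> L2" "g \<in> L2"
  shows "(\<lambda>x. f x + g x) \<in> L2"
proof -
  have m: "f \<in> borel_measurable lebesgue" "g \<in> borel_measurable lebesgue"
    and i: "integrable lebesgue (\<lambda>y. (f y)\<^sup>2)" "integrable lebesgue (\<lambda>y. (g y)\<^sup>2)"
    using assms by (auto simp: L2_def)
  have "integrable lebesgue (\<lambda>y. (f y + g y)\<^sup>2)"
  proof (rule Bochner_Integration.integrable_bound)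
    show "integrable lebesgue (\<lambda>y. 2 * (f y)\<^sup>2 + 2 * (g y)\<^sup>2)"
      using i by simp
    show "(\<lambda>y. (f y + g y)\<^sup>2) \<in> borel_measurable lebesgue"
      using m by (intro borel_measurable_power borel_measurable_add)
    have "(a + b)\<^sup>2 \<le> 2 * a\<^sup>2 + 2 * b\<^sup>2" for a b :: real
      using zero_le_power2[of "a - b"] by (simp add: power2_eq_square algebra_simps)
    then show "AE y in lebesgue. norm ((f y + g y)\<^sup>2) \<le> norm (2 * (f y)\<^sup>2 + 2 * (g y)\<^sup>2)"
      by (intro AE_I2) auto
  qed
  then show ?thesis using m by (auto simp: L2_def)
qed

lemma bc_loc_integrable: "bounded_continuous f \<Longrightarrow> loc_integrable f"
  by (auto simp: bounded_continuous_def intro: loc_integrable_continuous)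

lemma L2_Q_mult:
  assumes "bounded_continuous f"
  shows "(\<lambda>x. Q x * f x) \<in> L2"
proof -
  have "integrable lborel (\<lambda>x. Q x * (Q x * (f x * f x)))"
    by (intro bc_integrable bc_intros assms)
  moreover have "(\<lambda>x. Q x * (Q x * (f x * f x))) = (\<lambda>x. (Q x * f x)\<^sup>2)"
    by (auto simp: power2_eq_square mult_ac)
  ultimately have "integrable lebesgue (\<lambda>x. (Q x * f x)\<^sup>2)"
    using integrable_completion[of "\<lambda>x. (Q x * f x)\<^sup>2" lborel] by (simp add: borel_measurable_integrable)
  moreover have "loc_integrable (\<lambda>x. Q x * f x)"
    by (intro bc_loc_integrable bc_intros assms)
  ultimately show ?thesis by (simp add: L2_def loc_integrable_def)
qed

lemma AE_eq_if_same_dist: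
  assumes f: "loc_integrable f" and g: "loc_integrable g"
    and eq: "\<And>\<phi>. test_fun \<phi> \<Longrightarrow> (\<integral>x. f x * \<phi> x \<partial>lebesgue) = (\<integral>x. g x * \<phi> x \<partial>lebesgue)"
  shows "AE x in lebesgue. f x = g x"
proof -
  have "AE x in lebesgue. f x - g x = 0"
  proof (rule AE_zero_if_orthogonal_test_fun[OF loc_integrable_diff[OF f g]])
    fix \<phi> assume "test_fun \<phi>"
    then show "(\<integral>x. (f x - g x) * \<phi> x \<partial>lebesgue) = 0"
      using integrable_mult_test_fun[OF f] integrable_mult_test_fun[OF g] eq
      by (simp add: left_diff_distrib)
  qed
  then show ?thesis by simp
qed

lemma primitive_DERIV:
  fixes F G h :: "real \<Rightarrow> real"
  assumes F: "\<And>a b. a \<le> b \<Longrightarrow> F b - F a = integral {a..b} G"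
    and ae: "AE x in lebesgue. G x = h x" and h: "continuous_on UNIV h"
  shows "DERIV F x :> h x"
proof -
  obtain N where N: "N \<in> null_sets lebesgue" "{x. G x \<noteq> h x} \<subseteq> N"
    using ae by (auto simp: eventually_ae_filter)
  have Fh: "F b - F a = integral {a..b} h" if "a \<le> b" for a b
  proof -
    have "integral {a..b} h = integral {a..b} G"
      by (rule integral_spike[of N]) (use N in \<open>auto simp: negligible_iff_null_sets\<close>)
    then show ?thesis using F[OF that] by simp
  qed
  have "((\<lambda>u. integral {x-1..u} h) has_real_derivative h x) (at x within {x-1..x+1})"
    by (intro integral_has_real_derivative continuous_on_subset[OF h]) auto
  then have "((\<lambda>u. F (x-1) + integral {x-1..u} h) has_real_derivative h x) (at x within {x-1..x+1})"
    by (auto intro!: derivative_eq_intros)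
  then have "(F has_real_derivative h x) (at x within {x-1..x+1})"
  proof (rule has_field_derivative_transform_within[where d = 1])
    fix u assume "u \<in> {x-1..x+1}"
    then show "F (x-1) + integral {x-1..u} h = F u"
      using Fh[of "x-1" u] by simp
  qed auto
  then show ?thesis by (simp add: at_within_Icc_at)
qed

lemma L2_Lipschitz_tendsto_0:
  assumes g: "g \<in> L2" "continuous_on UNIV g"
    and D: "\<And>x. DERIV g x :> g' x" and B: "\<And>x. \<bar>g' x\<bar> \<le> B"
  shows "(g \<longlongrightarrow> 0) at_top" "(g \<longlongrightarrow> 0) at_bot"
proof -
  let ?s = "\<lambda>x. (g x)\<^sup>2"
  have c: "continuous_on UNIV ?s" by (intro continuous_intros g)
  obtain P where "continuous_on UNIV P" and P: "\<And>a b. a \<le> b \<Longrightarrow> P b - P a = integral {a..b} ?s"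
    by (rule primitive_exists[OF loc_integrable_continuous[OF c]]) (rule that)
  have i: "integrable lebesgue ?s" using g by (simp add: L2_def)
  have le: "\<bar>P b - P a\<bar> \<le> (\<integral>x. ?s x \<partial>lebesgue)" if "a \<le> b" for a b
  proof -
    have "P b - P a = (LINT x:{a..b}|lebesgue. ?s x)"
      unfolding P[OF that]
      by (intro set_lebesgue_integral_eq_integral(2)[symmetric] absolutely_integrable_continuous_real
          continuous_on_subset[OF c]) simp
    moreover have "0 \<le> (LINT x:{a..b}|lebesgue. ?s x)"
      unfolding set_lebesgue_integral_def by (intro Bochner_Integration.integral_nonneg) auto
    moreover have "(LINT x:{a..b}|lebesgue. ?s x) \<le> (\<integral>x. ?s x \<partial>lebesgue)"
      unfolding set_lebesgue_integral_def
      by (intro integral_mono i integrable_mult_indicator) (auto simp: indicator_def)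
    ultimately show ?thesis by simp
  qed
  have S: "\<bar>P x - P 0\<bar> \<le> (\<integral>x. ?s x \<partial>lebesgue)" for x
    using le[of 0 x] le[of x 0] by (cases "0 \<le> x") (auto simp: abs_minus_commute)
  have K: "DERIV (\<lambda>x. P x - P 0) x :> (g x)\<^sup>2" for x
    using primitive_DERIV[OF P _ c] by (auto intro!: derivative_eq_intros)
  show "(g \<longlongrightarrow> 0) at_top" "(g \<longlongrightarrow> 0) at_bot"
    by (rule sq_integrable_Lipschitz_tendsto_0[OF K S D B])+
qed

text \<open>The last two conditions express the same relation, distributionally and by integration; each form is convenient
for one half of the regularity argument.\<close>
definition weak_primitive :: "(real \<Rightarrow> real) \<Rightarrow> (real \<Rightarrow> real) \<Rightarrow> bool" where
  "weak_primitive F G \<longleftrightarrow> bounded_continuous F \<and> G \<in> L2 \<and>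
     (\<forall>\<phi>. test_fun \<phi> \<longrightarrow> (\<integral>x. F x * deriv \<phi> x \<partial>lebesgue) = - (\<integral>x. G x * \<phi> x \<partial>lebesgue)) \<and>
     (\<forall>a b. a \<le> b \<longrightarrow> F b - F a = integral {a..b} G)"

lemma weak_primitive_representative:
  assumes f: "f \<in> Linfty" "deriv_in_L2 f"
  obtains F G where "AE x in lebesgue. f x = F x" "weak_primitive F G"
proof -
  obtain G where G: "G \<in> L2" "dist_deriv (dist_of f) \<doteq> dist_of G"
    using f(2) by (auto simp: deriv_in_L2_def)
  have weak: "(\<integral>x. f x * deriv \<phi> x \<partial>lebesgue) = - (\<integral>x. G x * \<phi> x \<partial>lebesgue)" if "test_fun \<phi>" for \<phi>
    using G(2) that by (force simp: dist_eq_def dist_deriv_def dist_of_def)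
  obtain F where F: "continuous_on UNIV F" "AE x in lebesgue. f x = F x"
    "\<And>a b. a \<le> b \<Longrightarrow> F b - F a = integral {a..b} G"
    using du_Bois_Reymond[OF Linfty_loc_integrable[OF f(1)] L2_loc_integrable[OF G(1)] weak] by blast
  obtain M where "AE x in lebesgue. \<bar>f x\<bar> \<le> M"
    using f(1) by (auto simp: Linfty_def)
  with F(2) have M: "AE x in lebesgue. x \<in> {x. \<bar>F x\<bar> \<le> M}"
    by eventually_elim simp
  have "closed {x. \<bar>F x\<bar> \<le> M}"
    by (intro closed_Collect_le continuous_intros F(1))
  from mem_closed_if_AE_lebesgue[OF this M] have "\<bar>F x\<bar> \<le> M" for x by simp
  then have bc: "bounded_continuous F" using F(1) by (intro bcI)
  have eq: "(\<integral>x. f x * \<phi> x \<partial>lebesgue) = (\<integral>x. F x * \<phi> x \<partial>lebesgue)" for \<phi>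
    using fun_cong[OF dist_of_cong_AE[OF F(2)], of \<phi>] by (simp add: dist_of_def)
  show ?thesis
  proof
    show "AE x in lebesgue. f x = F x" by (rule F(2))
    show "weak_primitive F G"
      unfolding weak_primitive_def using bc G(1) weak F(3) by (auto simp: eq)
  qed
qed

text \<open>The weak derivative \<open>G\<close> has itself the continuous weak derivative \<open>h\<close>, so it has a \<open>C\<^sup>1\<close> representative, which
is Lipschitz and square integrable and therefore vanishes at infinity.\<close>
lemma weak_second_derivative:
  assumes F: "weak_primitive F G" and h: "bounded_continuous h"
    and weak: "\<And>\<phi>. test_fun \<phi> \<Longrightarrow> (\<integral>x. F x * deriv (deriv \<phi>) x \<partial>lebesgue) = (\<integral>x. h x * \<phi> x \<partial>lebesgue)"
  obtains F' where "\<And>x. DERIV F x :> F' x" "\<And>x. DERIV F' x :> h x"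
    "(F' \<longlongrightarrow> 0) at_top" "(F' \<longlongrightarrow> 0) at_bot"
proof -
  have G: "G \<in> L2" and FG: "\<And>a b. a \<le> b \<Longrightarrow> F b - F a = integral {a..b} G"
    and wG: "\<And>\<phi>. test_fun \<phi> \<Longrightarrow> (\<integral>x. F x * deriv \<phi> x \<partial>lebesgue) = - (\<integral>x. G x * \<phi> x \<partial>lebesgue)"
    using F by (auto simp: weak_primitive_def)
  have "(\<integral>x. G x * deriv \<phi> x \<partial>lebesgue) = - (\<integral>x. h x * \<phi> x \<partial>lebesgue)" if "test_fun \<phi>" for \<phi>
    using wG[OF test_fun_deriv[OF that]] weak[OF that] by simp
  then obtain F' where F': "continuous_on UNIV F'" "AE x in lebesgue. G x = F' x"
    "\<And>a b. a \<le> b \<Longrightarrow> F' b - F' a = integral {a..b} h"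
    using du_Bois_Reymond[OF L2_loc_integrable[OF G] bc_loc_integrable[OF h]] by blast
  have D: "DERIV F x :> F' x" for x
    by (rule primitive_DERIV[OF FG F'(2,1)])
  have hc: "continuous_on UNIV h" and "\<exists>M. \<forall>x. \<bar>h x\<bar> \<le> M"
    using h by (auto simp: bounded_continuous_def)
  then obtain M where M: "\<And>x. \<bar>h x\<bar> \<le> M" by blast
  have D': "DERIV F' x :> h x" for x
    by (rule primitive_DERIV[OF F'(3) _ hc]) auto
  have "(F' \<longlongrightarrow> 0) at_top" "(F' \<longlongrightarrow> 0) at_bot"
    by (rule L2_Lipschitz_tendsto_0[OF L2_AE[OF G F'(2)] F'(1) D' M])+
  then show ?thesis using that D D' by blast
qed

text \<open>The source is almost everywhere equal to a combination of the square integrable weak derivatives. Continuity of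
the source gives the classical equation; its square integrability yields decay of the unknowns.\<close>
lemma weak_transport:
  assumes F: "weak_primitive f f1" and G: "weak_primitive g g1" and h: "bounded_continuous h"
    and weak: "transport \<beta> f g \<doteq> dist_of h"
  shows "DERIV (\<lambda>x. f x - \<beta> * g x) x :> h x" and "h \<in> L2"
proof -
  have L2: "f1 \<in> L2" "g1 \<in> L2" using F G by (auto simp: weak_primitive_def)
  have loc: "loc_integrable f1" "loc_integrable g1"
    by (intro L2_loc_integrable L2)+
  have L: "(\<lambda>x. f1 x + (- \<beta>) * g1 x) \<in> L2"
    by (intro L2_add L2_scale L2)
  have ae: "AE x in lebesgue. f1 x + (- \<beta>) * g1 x = h x"
  proof (rule AE_eq_if_same_dist[OF L2_loc_integrable[OF L] bc_loc_integrable[OF h]])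
    fix \<phi> assume \<phi>: "test_fun \<phi>"
    have "(\<integral>x. (f1 x + (- \<beta>) * g1 x) * \<phi> x \<partial>lebesgue)
        = (\<integral>x. f1 x * \<phi> x \<partial>lebesgue) - \<beta> * (\<integral>x. g1 x * \<phi> x \<partial>lebesgue)"
      using integrable_mult_test_fun[OF loc(1) \<phi>] integrable_mult_test_fun[OF loc(2) \<phi>]
      by (simp add: left_diff_distrib mult.assoc)
    also have "\<dots> = (\<integral>x. h x * \<phi> x \<partial>lebesgue)"
      using weak F G \<phi> by (simp add: transport_def dist_eq_def dist_deriv_def dist_of_def weak_primitive_def)
    finally show "(\<integral>x. (f1 x + (- \<beta>) * g1 x) * \<phi> x \<partial>lebesgue) = (\<integral>x. h x * \<phi> x \<partial>lebesgue)" .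
  qed
  show "h \<in> L2" by (rule L2_AE[OF L ae])
  show "DERIV (\<lambda>x. f x - \<beta> * g x) x :> h x"
  proof (rule primitive_DERIV[OF _ ae])
    fix a b :: real assume ab: "a \<le> b"
    have i: "f1 integrable_on {a..b}" "g1 integrable_on {a..b}"
      by (intro loc_integrable_integrable_on loc)+
    have "integral {a..b} (\<lambda>x. f1 x + (- \<beta>) * g1 x) = integral {a..b} f1 - \<beta> * integral {a..b} g1"
      using Henstock_Kurzweil_Integration.integral_add[OF i(1) integrable_on_mult_right[OF i(2), of "- \<beta>"]]
      by simp
    then show "(f b - \<beta> * g b) - (f a - \<beta> * g a) = integral {a..b} (\<lambda>x. f1 x + (- \<beta>) * g1 x)"
      using F G ab by (simp add: weak_primitive_def algebra_simps flip: right_diff_distrib)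
  qed (use h in \<open>auto simp: bounded_continuous_def\<close>)
qed

lemma L_minus_weak:
  assumes f: "bounded_continuous f" and g: "bounded_continuous g"
    and eq: "L_minus (dist_of f) \<doteq> dist_of g" and \<phi>: "test_fun \<phi>"
  shows "(\<integral>x. f x * deriv (deriv \<phi>) x \<partial>lebesgue) = (\<integral>x. (f x - (Q x)\<^sup>2 * f x - g x) * \<phi> x \<partial>lebesgue)"
proof -
  have b: "bounded_continuous (\<lambda>x. Q x * (Q x * f x))"
    by (intro bc_intros f)
  have e: "(\<lambda>x. f x * ((Q x)\<^sup>2 * \<phi> x)) = (\<lambda>x. (Q x * (Q x * f x)) * \<phi> x)"
    "(\<lambda>x. (f x - (Q x)\<^sup>2 * f x - g x) * \<phi> x) = (\<lambda>x. f x * \<phi> x - (Q x * (Q x * f x)) * \<phi> x - g x * \<phi> x)"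
    by (auto simp: power2_eq_square algebra_simps)
  note i = integrable_mult_test_fun[OF bc_loc_integrable[OF f] \<phi>]
    integrable_mult_test_fun[OF bc_loc_integrable[OF g] \<phi>]
    integrable_mult_test_fun[OF bc_loc_integrable[OF b] \<phi>]
  have "- (\<integral>x. f x * deriv (deriv \<phi>) x \<partial>lebesgue) + (\<integral>x. f x * \<phi> x \<partial>lebesgue)
      - (\<integral>x. f x * ((Q x)\<^sup>2 * \<phi> x) \<partial>lebesgue) = (\<integral>x. g x * \<phi> x \<partial>lebesgue)"
    using eq \<phi> by (simp add: L_minus_def dist_eq_def dist_deriv_def dist_of_def dist_mult_def)
  then show ?thesis
    unfolding e using i by simp
qed

lemma L_plus_weak:
  assumes f: "bounded_continuous f" and g: "bounded_continuous g"
    and eq: "L_plus (dist_of f) \<doteq> dist_of g" and \<phi>: "test_fun \<phi>"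
  shows "(\<integral>x. f x * deriv (deriv \<phi>) x \<partial>lebesgue) = (\<integral>x. (f x - 3 * (Q x)\<^sup>2 * f x - g x) * \<phi> x \<partial>lebesgue)"
proof -
  have b: "bounded_continuous (\<lambda>x. Q x * (Q x * f x))"
    by (intro bc_intros f)
  have e: "(\<lambda>x. f x * ((Q x)\<^sup>2 * \<phi> x)) = (\<lambda>x. (Q x * (Q x * f x)) * \<phi> x)"
    "(\<lambda>x. (f x - 3 * (Q x)\<^sup>2 * f x - g x) * \<phi> x)
      = (\<lambda>x. f x * \<phi> x - 3 * ((Q x * (Q x * f x)) * \<phi> x) - g x * \<phi> x)"
    by (auto simp: power2_eq_square algebra_simps)
  note i = integrable_mult_test_fun[OF bc_loc_integrable[OF f] \<phi>]
    integrable_mult_test_fun[OF bc_loc_integrable[OF g] \<phi>]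
    integrable_mult_test_fun[OF bc_loc_integrable[OF b] \<phi>]
  have "- (\<integral>x. f x * deriv (deriv \<phi>) x \<partial>lebesgue) + (\<integral>x. f x * \<phi> x \<partial>lebesgue)
      - 3 * (\<integral>x. f x * ((Q x)\<^sup>2 * \<phi> x) \<partial>lebesgue) = (\<integral>x. g x * \<phi> x \<partial>lebesgue)"
    using eq \<phi> by (simp add: L_plus_def dist_eq_def dist_deriv_def dist_of_def dist_mult_def)
  then show ?thesis
    unfolding e using i by simp
qed

lemma spectral_system_cong_AE:
  assumes "AE x in lebesgue. C1 x = c1 x" "AE x in lebesgue. S1 x = s1 x"
    "AE x in lebesgue. C2 x = c2 x" "AE x in lebesgue. S2 x = s2 x"
    "AE x in lebesgue. CN x = cN x" "AE x in lebesgue. SN x = sN x"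
    "AE x in lebesgue. CV x = cV x" "AE x in lebesgue. SV x = sV x"
    and sys: "spectral_system \<beta> \<omega> \<mu> C1 S1 C2 S2 CN SN CV SV"
  shows "spectral_system \<beta> \<omega> \<mu> c1 s1 c2 s2 cN sN cV sV"
proof -
  have d: "dist_of C1 = dist_of c1" "dist_of S1 = dist_of s1" "dist_of C2 = dist_of c2"
    "dist_of S2 = dist_of s2" "dist_of CN = dist_of cN" "dist_of SN = dist_of sN"
    "dist_of CV = dist_of cV" "dist_of SV = dist_of sV"
    by (intro dist_of_cong_AE assms)+
  have r: "dist_of (\<lambda>y. h y (f y) (g y)) = dist_of (\<lambda>y. h y (f' y) (g' y))"
    if "AE x in lebesgue. f x = f' x" "AE x in lebesgue. g x = g' x"
    for h :: "real \<Rightarrow> real \<Rightarrow> real \<Rightarrow> real" and f g f' g' :: "real \<Rightarrow> real"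
    using that by (intro dist_of_cong_AE) (auto elim!: eventually_elim2)
  show ?thesis
    using sys unfolding spectral_system_def transport_def d
      r[where h = "\<lambda>y a b. \<mu> * a", OF assms(2,2)]
      r[where h = "\<lambda>y a b. \<mu> * a + Q y * b", OF assms(3,6)]
      r[where h = "\<lambda>y a b. - \<mu> * a", OF assms(1,1)]
      r[where h = "\<lambda>y a b. - \<mu> * a + Q y * b", OF assms(4,5)]
      r[where h = "\<lambda>y a b. - \<mu> * sqrt \<omega> * (a + 2 * Q y * b)", OF assms(6,2)]
      r[where h = "\<lambda>y a b. \<mu> * sqrt \<omega> * (a + 2 * Q y * b)", OF assms(5,1)]
      r[where h = "\<lambda>y a b. - \<mu> * sqrt \<omega> * (a + 2 * \<beta> * Q y * b)", OF assms(8,2)]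
      r[where h = "\<lambda>y a b. \<mu> * sqrt \<omega> * (a + 2 * \<beta> * Q y * b)", OF assms(7,1)] .
qed

section \<open>The spectral system\<close>

lemma bc_diff: "bounded_continuous f \<Longrightarrow> bounded_continuous g \<Longrightarrow> bounded_continuous (\<lambda>x. f x - g x)"
  using bc_add[of f "\<lambda>x. (-1) * g x"] bc_mult[OF bc_const[of "-1"], of g] by simp

lemma bc_power2: "bounded_continuous f \<Longrightarrow> bounded_continuous (\<lambda>x. (f x)\<^sup>2)"
  unfolding power2_eq_square by (rule bc_mult)

lemma bc_uminus: "bounded_continuous f \<Longrightarrow> bounded_continuous (\<lambda>x. - f x)"
  using bc_mult[OF bc_const[of "-1"], of f] by simp

text \<open>The two transport equations determine \<open>f'\<close>, because \<open>\<beta>\<^sup>2 < 1\<close>, and show that \<open>f\<close> is Lipschitz.\<close>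
lemma decay_from_sources:
  assumes \<beta>: "-1 < \<beta>" "\<beta> < 1" and f: "bounded_continuous f" "f \<in> L2"
    and D1: "\<And>x. DERIV (\<lambda>x. f x - \<beta> * g x) x :> h1 x" "bounded_continuous h1"
    and D2: "\<And>x. DERIV (\<lambda>x. g x - \<beta> * f x) x :> h2 x" "bounded_continuous h2"
  shows "(f \<longlongrightarrow> 0) at_top"
proof -
  have ne: "1 - \<beta>\<^sup>2 \<noteq> 0"
    using \<beta> by (metis abs_less_iff abs_square_less_1 eq_iff_diff_eq_0 less_irrefl minus_less_iff)
  have "f = (\<lambda>x. ((f x - \<beta> * g x) + \<beta> * (g x - \<beta> * f x)) / (1 - \<beta>\<^sup>2))"
    using ne by (auto simp: field_simps power2_eq_square)
  moreover have "DERIV (\<lambda>x. ((f x - \<beta> * g x) + \<beta> * (g x - \<beta> * f x)) / (1 - \<beta>\<^sup>2)) x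
      :> (h1 x + \<beta> * h2 x) / (1 - \<beta>\<^sup>2)" for x
    by (intro DERIV_cdivide DERIV_add DERIV_cmult D1 D2)
  ultimately have D: "DERIV f x :> (h1 x + \<beta> * h2 x) / (1 - \<beta>\<^sup>2)" for x
    by simp
  have "bounded_continuous (\<lambda>x. (h1 x + \<beta> * h2 x) * (1 / (1 - \<beta>\<^sup>2)))"
    by (intro bc_intros D1 D2)
  then obtain M where "\<And>x. \<bar>(h1 x + \<beta> * h2 x) / (1 - \<beta>\<^sup>2)\<bar> \<le> M"
    by (auto simp: bounded_continuous_def)
  then show ?thesis
    using f by (intro L2_Lipschitz_tendsto_0(1)[OF _ _ D]) (auto simp: bounded_continuous_def)
qed

lemma spectral_solution_trivial:
  assumes \<beta>: "-1 < \<beta>" "\<beta> < 1" and \<epsilon>: "0 < sqrt \<omega>" "10^11 * sqrt \<omega> \<le> 1 - \<beta>\<^sup>2"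
    and wp: "weak_primitive c1 c1'" "weak_primitive s1 s1'" "weak_primitive c2 c2'" "weak_primitive s2 s2'"
      "weak_primitive cN cN'" "weak_primitive sN sN'" "weak_primitive cV cV'" "weak_primitive sV sV'"
    and sys: "spectral_system \<beta> \<omega> 1 c1 s1 c2 s2 cN sN cV sV"
  shows "c1 x = 0 \<and> s1 x = 0 \<and> c2 x = 0 \<and> s2 x = 0 \<and> cN x = 0 \<and> sN x = 0 \<and> cV x = 0 \<and> sV x = 0"
proof -
  define \<epsilon> where "\<epsilon> = sqrt \<omega>"
  have bc: "bounded_continuous c1" "bounded_continuous s1" "bounded_continuous c2" "bounded_continuous s2"
    "bounded_continuous cN" "bounded_continuous sN" "bounded_continuous cV" "bounded_continuous sV"
    using wp by (simp_all add: weak_primitive_def)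
  note bcs = bc_intros bc_diff bc_uminus bc_power2 bc
  have e1: "L_minus (dist_of c2) \<doteq> dist_of s1"
    and e2: "L_plus (dist_of s1) \<doteq> dist_of (\<lambda>y. c2 y + Q y * sN y)"
    and e3: "L_minus (dist_of s2) \<doteq> dist_of (\<lambda>y. - c1 y)"
    and e4: "L_plus (dist_of c1) \<doteq> dist_of (\<lambda>y. - s2 y + Q y * cN y)"
    and e5: "transport \<beta> cV cN \<doteq> dist_of (\<lambda>y. - \<epsilon> * (sN y + 2 * Q y * s1 y))"
    and e6: "transport \<beta> sV sN \<doteq> dist_of (\<lambda>y. \<epsilon> * (cN y + 2 * Q y * c1 y))"
    and e7: "transport \<beta> cN cV \<doteq> dist_of (\<lambda>y. - \<epsilon> * (sV y + 2 * \<beta> * Q y * s1 y))"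
    and e8: "transport \<beta> sN sV \<doteq> dist_of (\<lambda>y. \<epsilon> * (cV y + 2 * \<beta> * Q y * c1 y))"
    using sys unfolding spectral_system_def \<epsilon>_def by simp_all
  have b1: "bounded_continuous (\<lambda>x. c2 x - (Q x)\<^sup>2 * c2 x - s1 x)"
    and b2: "bounded_continuous (\<lambda>x. s1 x - 3 * (Q x)\<^sup>2 * s1 x - (c2 x + Q x * sN x))"
    and b3: "bounded_continuous (\<lambda>x. s2 x - (Q x)\<^sup>2 * s2 x - - c1 x)"
    and g2: "bounded_continuous (\<lambda>x. c2 x + Q x * sN x)"
    and g3: "bounded_continuous (\<lambda>x. - c1 x)"
    and g4: "bounded_continuous (\<lambda>x. - s2 x + Q x * cN x)"
    and b4: "bounded_continuous (\<lambda>x. c1 x - 3 * (Q x)\<^sup>2 * c1 x - (- s2 x + Q x * cN x))"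
    by (intro bcs)+
  obtain c2d where c2d: "\<And>x. DERIV c2 x :> c2d x" "\<And>x. DERIV c2d x :> c2 x - (Q x)\<^sup>2 * c2 x - s1 x"
    "(c2d \<longlongrightarrow> 0) at_top" "(c2d \<longlongrightarrow> 0) at_bot"
    by (rule weak_second_derivative[OF wp(3) b1 L_minus_weak[OF bc(3,2) e1]]) (assumption, rule that)
  obtain s1d where s1d: "\<And>x. DERIV s1 x :> s1d x"
    "\<And>x. DERIV s1d x :> s1 x - 3 * (Q x)\<^sup>2 * s1 x - (c2 x + Q x * sN x)"
    "(s1d \<longlongrightarrow> 0) at_top" "(s1d \<longlongrightarrow> 0) at_bot"
    by (rule weak_second_derivative[OF wp(2) b2 L_plus_weak[OF bc(2) g2 e2]]) (assumption, rule that)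
  obtain s2d where s2d: "\<And>x. DERIV s2 x :> s2d x" "\<And>x. DERIV s2d x :> s2 x - (Q x)\<^sup>2 * s2 x - - c1 x"
    "(s2d \<longlongrightarrow> 0) at_top" "(s2d \<longlongrightarrow> 0) at_bot"
    by (rule weak_second_derivative[OF wp(4) b3 L_minus_weak[OF bc(4) g3 e3]]) (assumption, rule that)
  obtain c1d where c1d: "\<And>x. DERIV c1 x :> c1d x"
    "\<And>x. DERIV c1d x :> c1 x - 3 * (Q x)\<^sup>2 * c1 x - (- s2 x + Q x * cN x)"
    "(c1d \<longlongrightarrow> 0) at_top" "(c1d \<longlongrightarrow> 0) at_bot"
    by (rule weak_second_derivative[OF wp(1) b4 L_plus_weak[OF bc(1) g4 e4]]) (assumption, rule that)
  obtain B where B: "\<And>x. \<bar>c1 x\<bar> \<le> B" "\<And>x. \<bar>s1 x\<bar> \<le> B" "\<And>x. \<bar>c2 x\<bar> \<le> B" "\<And>x. \<bar>s2 x\<bar> \<le> B"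
  proof -
    obtain B1 B2 B3 B4 where "\<And>x. \<bar>c1 x\<bar> \<le> B1" "\<And>x. \<bar>s1 x\<bar> \<le> B2" "\<And>x. \<bar>c2 x\<bar> \<le> B3" "\<And>x. \<bar>s2 x\<bar> \<le> B4"
      using bc(1-4) by (auto simp: bounded_continuous_def)
    then show ?thesis
      by (intro that[of "max (max B1 B2) (max B3 B4)"]) (auto simp: le_max_iff_disj)
  qed
  have solC: "forced_solution c1 c1d (\<lambda>x. - s2 x) (\<lambda>x. - s2d x) cN B"
  proof
    fix x
    show "DERIV c1d x :> c1 x - 3 * (Q x)\<^sup>2 * c1 x - - s2 x - Q x * cN x"
      by (rule DERIV_cong[OF c1d(2)]) simp
    show "DERIV (\<lambda>x. - s2 x) x :> - s2d x" by (intro DERIV_minus s2d)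
    show "DERIV (\<lambda>x. - s2d x) x :> - s2 x - (Q x)\<^sup>2 * - s2 x - c1 x"
      by (rule DERIV_cong[OF DERIV_minus[OF s2d(2)]]) simp
    show "((\<lambda>x. - s2d x) \<longlongrightarrow> 0) at_top" "((\<lambda>x. - s2d x) \<longlongrightarrow> 0) at_bot"
      using tendsto_minus[OF s2d(3)] tendsto_minus[OF s2d(4)] by simp_all
    show "continuous_on UNIV cN" using bc(5) by (simp add: bounded_continuous_def)
  qed (use c1d B in auto)
  have solS: "forced_solution s1 s1d c2 c2d sN B"
  proof
    fix x
    show "DERIV s1d x :> s1 x - 3 * (Q x)\<^sup>2 * s1 x - c2 x - Q x * sN x"
      by (rule DERIV_cong[OF s1d(2)]) simp
    show "continuous_on UNIV sN" using bc(6) by (simp add: bounded_continuous_def)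
  qed (use s1d c2d B in auto)
  have bh: "bounded_continuous (\<lambda>y. - \<epsilon> * (sN y + 2 * Q y * s1 y))"
    "bounded_continuous (\<lambda>y. \<epsilon> * (cN y + 2 * Q y * c1 y))"
    "bounded_continuous (\<lambda>y. - \<epsilon> * (sV y + 2 * \<beta> * Q y * s1 y))"
    "bounded_continuous (\<lambda>y. \<epsilon> * (cV y + 2 * \<beta> * Q y * c1 y))"
    by (intro bcs)+
  note tr = weak_transport[OF wp(7,5) bh(1) e5] weak_transport[OF wp(8,6) bh(2) e6]
    weak_transport[OF wp(5,7) bh(3) e7] weak_transport[OF wp(6,8) bh(4) e8]
  \<comment> \<open>the sources of the transport equations are square integrable and contain the unknowns themselves up to the
localized terms with \<open>Q\<close>\<close>
  have L2: "g \<in> L2" if L: "(\<lambda>y. a * (g y + 2 * b * Q y * f y)) \<in> L2" and a: "a \<noteq> 0"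
    and f: "bounded_continuous f" for a b f g
  proof -
    have "(\<lambda>y. (1 / a) * (a * (g y + 2 * b * Q y * f y)) + (- 2 * b) * (Q y * f y)) \<in> L2"
      by (intro L2_add L2_scale L L2_Q_mult f)
    then show ?thesis using a by (simp add: algebra_simps)
  qed
  have e: "\<epsilon> \<noteq> 0" "- \<epsilon> \<noteq> 0" using \<epsilon>(1) by (simp_all add: \<epsilon>_def)
  have in_L2: "sN \<in> L2" "cN \<in> L2" "sV \<in> L2" "cV \<in> L2"
    using L2[of "- \<epsilon>" sN 1 s1] L2[of \<epsilon> cN 1 c1] L2[OF tr(6) e(2) bc(2)] L2[OF tr(8) e(1) bc(1)]
      tr(2,4) e bc by simp_all
  have lim: "(cN \<longlongrightarrow> 0) at_top" "(sN \<longlongrightarrow> 0) at_top" "(cV \<longlongrightarrow> 0) at_top" "(sV \<longlongrightarrow> 0) at_top"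
    by (rule decay_from_sources[OF \<beta> bc(5) in_L2(2) tr(5) bh(3) tr(1) bh(1)],
        rule decay_from_sources[OF \<beta> bc(6) in_L2(1) tr(7) bh(4) tr(3) bh(2)],
        rule decay_from_sources[OF \<beta> bc(7) in_L2(4) tr(1) bh(1) tr(5) bh(3)],
        rule decay_from_sources[OF \<beta> bc(8) in_L2(3) tr(3) bh(2) tr(7) bh(4)])
  note zero = no_classical_solution[OF \<beta> \<epsilon>[folded \<epsilon>_def] solC solS tr(1,3,5,7) bc(5,6,7,8) lim]
  show ?thesis
    using zero by simp
qed

theorem mainTheorem3:
  fixes \<beta> :: real
  assumes "-1 < \<beta>" and "\<beta> < 1"
  shows "\<exists>\<omega>\<^sub>0>0. \<forall>\<omega>. 0 < \<omega> \<and> \<omega> < \<omega>\<^sub>0 \<longrightarrow>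
    \<not> (\<exists>C1 S1 C2 S2 CN SN CV SV :: real \<Rightarrow> real.
        (\<exists>f\<in>{C1, S1, C2, S2, CN, SN, CV, SV}. \<not> (AE y in lebesgue. f y = 0)) \<and>
        (\<forall>f\<in>{C1, S1, C2, S2, CN, SN, CV, SV}. f \<in> Linfty \<and> deriv_in_L2 f) \<and>
        spectral_system \<beta> \<omega> 1 C1 S1 C2 S2 CN SN CV SV)"
proof -
  have \<beta>2: "0 < 1 - \<beta>\<^sup>2"
    using assms by (simp add: abs_square_less_1 abs_less_iff)
  define \<omega>\<^sub>0 where "\<omega>\<^sub>0 = ((1 - \<beta>\<^sup>2) / 10^11)\<^sup>2"
  have "\<omega>\<^sub>0 > 0" using \<beta>2 by (simp add: \<omega>\<^sub>0_def)
  moreover have False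
    if \<omega>: "0 < \<omega>" "\<omega> < \<omega>\<^sub>0"
      and nz: "\<exists>f\<in>{C1, S1, C2, S2, CN, SN, CV, SV}. \<not> (AE y in lebesgue. f y = 0)"
      and reg: "\<forall>f\<in>{C1, S1, C2, S2, CN, SN, CV, SV}. f \<in> Linfty \<and> deriv_in_L2 f"
      and sys: "spectral_system \<beta> \<omega> 1 C1 S1 C2 S2 CN SN CV SV"
    for \<omega> and C1 S1 C2 S2 CN SN CV SV :: "real \<Rightarrow> real"
  proof -
    let ?A = "{C1, S1, C2, S2, CN, SN, CV, SV}"
    have "\<forall>f\<in>?A. \<exists>F. (AE x in lebesgue. f x = F x) \<and> (\<exists>G. weak_primitive F G)"
    proof
      fix f assume "f \<in> ?A"
      then have "f \<in> Linfty" "deriv_in_L2 f" using reg by blast+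
      then obtain F G where "AE x in lebesgue. f x = F x" "weak_primitive F G"
        by (rule weak_primitive_representative)
      then show "\<exists>F. (AE x in lebesgue. f x = F x) \<and> (\<exists>G. weak_primitive F G)" by blast
    qed
    from bchoice[OF this] obtain rep
      where r: "\<forall>f\<in>?A. (AE x in lebesgue. f x = rep f x) \<and> (\<exists>G. weak_primitive (rep f) G)" ..
    then have "\<forall>f\<in>?A. \<exists>G. weak_primitive (rep f) G" by blast
    from bchoice[OF this] obtain drep where d: "\<forall>f\<in>?A. weak_primitive (rep f) (drep f)" ..
    have rep: "AE x in lebesgue. f x = rep f x" "weak_primitive (rep f) (drep f)" if "f \<in> ?A" for f
      using r d that by blast+
    have "sqrt \<omega> < (1 - \<beta>\<^sup>2) / 10^11"
      using \<omega> \<beta>2 real_sqrt_less_mono[OF \<omega>(2)] by (simp add: \<omega>\<^sub>0_def)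
    then have small: "0 < sqrt \<omega>" "10^11 * sqrt \<omega> \<le> 1 - \<beta>\<^sup>2"
      using \<omega> by (simp_all add: field_simps)
    have "spectral_system \<beta> \<omega> 1 (rep C1) (rep S1) (rep C2) (rep S2) (rep CN) (rep SN) (rep CV) (rep SV)"
      by (rule spectral_system_cong_AE[OF _ _ _ _ _ _ _ _ sys]) (rule rep, simp)+
    moreover have "weak_primitive (rep C1) (drep C1)" "weak_primitive (rep S1) (drep S1)"
      "weak_primitive (rep C2) (drep C2)" "weak_primitive (rep S2) (drep S2)"
      "weak_primitive (rep CN) (drep CN)" "weak_primitive (rep SN) (drep SN)"
      "weak_primitive (rep CV) (drep CV)" "weak_primitive (rep SV) (drep SV)"
      by (rule rep(2), simp)+
    ultimately have zero: "rep C1 x = 0 \<and> rep S1 x = 0 \<and> rep C2 x = 0 \<and> rep S2 x = 0 \<and>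
        rep CN x = 0 \<and> rep SN x = 0 \<and> rep CV x = 0 \<and> rep SV x = 0" for x
      by (intro spectral_solution_trivial[OF assms small])
    then have "rep f x = 0" if "f \<in> {C1, S1, C2, S2, CN, SN, CV, SV}" for f x
      using that by (elim insertE emptyE) simp_all
    then have "AE y in lebesgue. f y = 0" if "f \<in> {C1, S1, C2, S2, CN, SN, CV, SV}" for f
      using rep(1)[OF that] that by auto
    then show False using nz by blast
  qed
  ultimately show ?thesis by blast
qed

end
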